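(* Let $S$ be a Boolean inverse semigroup. The type monoid of $S$ is (isomorphic to) the free abelian monoid on a non-empty set $X$ if and only if $S$ is semisimple. (That is: there exists a non-empty set $X$ such that $\mathsf{T}(S)$ is isomorphic to the free abelian monoid on $X$ if and only if $S$ is semisimple.)
   Context: For an inverse semigroup $S$, $\mathsf{E}(S)$ is its set of idempotents. The natural partial order is $a\le b$ iff $a=ba^{-1}a$; joins and meets refer to it; $a^{\downarrow}=\{x: x\le a\}$. Elements $a,b$ are compatible if $a^{-1}b$ and $ab^{-1}$ are both idempotents; when $S$ has a zero they are orthogonal, $a\perp b$, if $a^{-1}b=0=ab^{-1}$. A Boolean algebra here means a generalized Boolean algebra: a distributive lattice with bottom (a top is not required) in which every principal order-ideal is a (unital) Boolean algebra. An inverse semigroup with zero is distributive if any two compatible elements have a join and multiplication distributes on both sides over such joins; it is Boolean if in addition $(\mathsf{E}(S),\le)$ is a Boolean algebra. Boolean inverse semigroups are assumed not to be the zero semigroup $\{0\}$. $S$ is semisimple if $a^{\downarrow}$ is finite for each $a\in S$. For idempotents, $e\,\mathscr{D}\,f$ iff there is $a$ with $a^{-1}a=e$ and $aa^{-1}=f$. An orthogonal join is written $\oplus$. $M_{\omega}(S)$ is the set of $\omega\times\omega$ rook matrices over $S$: matrices with countably infinitely many rows and columns, entries in $S$, only finitely many entries non-zero, such that if $a,b$ lie in the same row and distinct columns then $a^{-1}b=0$, and if $a,b$ lie in the same column and distinct rows then $ab^{-1}=0$. Multiplication is $(AB)_{ij}=\bigoplus_k a_{ik}b_{kj}$. $M_{\omega}(S)$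 is a Boolean inverse semigroup and is orthogonally separating: for any idempotents $e,f$ there are idempotents $e'\,\mathscr{D}\,e$ and $f'\,\mathscr{D}\,f$ with $e'\perp f'$. The type monoid $\mathsf{T}(S)$ is the set $\mathsf{E}(M_{\omega}(S))/\mathscr{D}$ of $\mathscr{D}$-classes $[e]$ of idempotents, with the commutative addition $[e]+[f]=[e'\vee f']$ where $e'\,\mathscr{D}\,e$, $f'\,\mathscr{D}\,f$ and $e'\perp f'$ (this is well defined), and identity $[0]$. *)

theory Defs
  imports "HOL-Library.Multiset" "HOL-Algebra.Group"
begin

text \<open>
  The record \<open>monoid\<close> of \<open>HOL-Algebra\<close> carries a unit, which neither a Boolean
  inverse semigroup nor its semigroup of \<open>\<omega> \<times> \<omega>\<close> rook matrices has in general;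
  a semigroup with zero is therefore a record of its own.
\<close>

record 'a semigroup_with_zero = "'a partial_object" +
  sg_mult :: "'a \<Rightarrow> 'a \<Rightarrow> 'a"  (infixl \<open>\<cdot>\<index>\<close> 70)
  sg_zero :: 'a

locale inverse_semigroup = fixes S (structure)
  assumes sg_closed: "\<lbrakk>a \<in> carrier S; b \<in> carrier S\<rbrakk> \<Longrightarrow> a \<cdot> b \<in> carrier S"
    and sg_assoc: "\<lbrakk>a \<in> carrier S; b \<in> carrier S; c \<in> carrier S\<rbrakk> \<Longrightarrow> a \<cdot> b \<cdot> c = a \<cdot> (b \<cdot> c)"
    and ex1_inverse: "a \<in> carrier S \<Longrightarrow> \<exists>!b. b \<in> carrier S \<and> a \<cdot> b \<cdot> a = a \<and> b \<cdot> a \<cdot> b = b"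

definition sg_inv :: "('a, 'b) semigroup_with_zero_scheme \<Rightarrow> 'a \<Rightarrow> 'a" where
  "sg_inv S a = (THE b. b \<in> carrier S \<and> a \<cdot>\<^bsub>S\<^esub> b \<cdot>\<^bsub>S\<^esub> a = a \<and> b \<cdot>\<^bsub>S\<^esub> a \<cdot>\<^bsub>S\<^esub> b = b)"

definition idempotents :: "('a, 'b) semigroup_with_zero_scheme \<Rightarrow> 'a set" where
  "idempotents S = {e \<in> carrier S. e \<cdot>\<^bsub>S\<^esub> e = e}"

definition natural_order :: "('a, 'b) semigroup_with_zero_scheme \<Rightarrow> 'a gorder" where
  "natural_order S =
     \<lparr>carrier = carrier S, eq = (=), le = (\<lambda>a b. a = b \<cdot>\<^bsub>S\<^esub> (sg_inv S a \<cdot>\<^bsub>S\<^esub> a))\<rparr>"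

definition compatible :: "('a, 'b) semigroup_with_zero_scheme \<Rightarrow> 'a \<Rightarrow> 'a \<Rightarrow> bool" where
  "compatible S a b \<longleftrightarrow>
     sg_inv S a \<cdot>\<^bsub>S\<^esub> b \<in> idempotents S \<and> a \<cdot>\<^bsub>S\<^esub> sg_inv S b \<in> idempotents S"

definition orthogonal :: "('a, 'b) semigroup_with_zero_scheme \<Rightarrow> 'a \<Rightarrow> 'a \<Rightarrow> bool" where
  "orthogonal S a b \<longleftrightarrow> sg_inv S a \<cdot>\<^bsub>S\<^esub> b = sg_zero S \<and> a \<cdot>\<^bsub>S\<^esub> sg_inv S b = sg_zero S"

definition D_relation :: "('a, 'b) semigroup_with_zero_scheme \<Rightarrow> ('a \<times> 'a) set" where
  "D_relation S =
     {(e, f). e \<in> idempotents S \<and> f \<in> idempotents S \<and>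
        (\<exists>a \<in> carrier S. sg_inv S a \<cdot>\<^bsub>S\<^esub> a = e \<and> a \<cdot>\<^bsub>S\<^esub> sg_inv S a = f)}"

definition semisimple :: "('a, 'b) semigroup_with_zero_scheme \<Rightarrow> bool" where
  "semisimple S \<longleftrightarrow>
     (\<forall>a \<in> carrier S. finite {x \<in> carrier S. x \<sqsubseteq>\<^bsub>natural_order S\<^esub> a})"

definition distributive_lattice_on :: "('a, 'b) gorder_scheme \<Rightarrow> bool" where
  "distributive_lattice_on L \<longleftrightarrow> Lattice.lattice L \<and>
     (\<forall>x \<in> carrier L. \<forall>y \<in> carrier L. \<forall>z \<in> carrier L.
        x \<sqinter>\<^bsub>L\<^esub> (y \<squnion>\<^bsub>L\<^esub> z) = (x \<sqinter>\<^bsub>L\<^esub> y) \<squnion>\<^bsub>L\<^esub> (x \<sqinter>\<^bsub>L\<^esub> z))"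

definition unital_boolean_algebra_on :: "('a, 'b) gorder_scheme \<Rightarrow> bool" where
  "unital_boolean_algebra_on L \<longleftrightarrow> Lattice.bounded_lattice L \<and> distributive_lattice_on L \<and>
     (\<forall>x \<in> carrier L. \<exists>y \<in> carrier L. x \<sqinter>\<^bsub>L\<^esub> y = \<bottom>\<^bsub>L\<^esub> \<and> x \<squnion>\<^bsub>L\<^esub> y = \<top>\<^bsub>L\<^esub>)"

definition generalized_boolean_algebra_on :: "('a, 'b) gorder_scheme \<Rightarrow> bool" where
  "generalized_boolean_algebra_on L \<longleftrightarrow>
     distributive_lattice_on L \<and> (\<exists>x. least L x (carrier L)) \<and>
     (\<forall>e \<in> carrier L.
        unital_boolean_algebra_on (L\<lparr>carrier := {x \<in> carrier L. x \<sqsubseteq>\<^bsub>L\<^esub> e}\<rparr>))"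

locale inverse_semigroup_with_zero = inverse_semigroup +
  assumes zero_closed: "sg_zero S \<in> carrier S"
    and zero_left: "a \<in> carrier S \<Longrightarrow> sg_zero S \<cdot> a = sg_zero S"
    and zero_right: "a \<in> carrier S \<Longrightarrow> a \<cdot> sg_zero S = sg_zero S"

locale distributive_inverse_semigroup = inverse_semigroup_with_zero +
  assumes compatible_join_exists:
    "\<lbrakk>a \<in> carrier S; b \<in> carrier S; compatible S a b\<rbrakk> \<Longrightarrow>
       \<exists>s. least (natural_order S) s (Upper (natural_order S) {a, b})"
    and distrib_left:
    "\<lbrakk>a \<in> carrier S; b \<in> carrier S; c \<in> carrier S; compatible S a b;
      least (natural_order S) s (Upper (natural_order S) {a, b})\<rbrakk> \<Longrightarrow>
       least (natural_order S) (c \<cdot> s) (Upper (natural_order S) {c \<cdot> a, c \<cdot> b})"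
    and distrib_right:
    "\<lbrakk>a \<in> carrier S; b \<in> carrier S; c \<in> carrier S; compatible S a b;
      least (natural_order S) s (Upper (natural_order S) {a, b})\<rbrakk> \<Longrightarrow>
       least (natural_order S) (s \<cdot> c) (Upper (natural_order S) {a \<cdot> c, b \<cdot> c})"

locale boolean_inverse_semigroup = distributive_inverse_semigroup +
  assumes idempotents_boolean:
    "generalized_boolean_algebra_on ((natural_order S)\<lparr>carrier := idempotents S\<rparr>)"
    and nontrivial: "carrier S \<noteq> {sg_zero S}"

text \<open>
  In a product of rook matrices over a Boolean inverse semigroup, only finitely many of the
  elements \<open>A i k \<cdot> B k j\<close>, for fixed \<open>i\<close> and \<open>j\<close>, are non-zero, and those for distinct \<open>k\<close>
  are orthogonal. The supremum below is thus a finite orthogonal join; the zero entries do not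
  affect it.
\<close>

definition rook_matrices ::
    "('a, 'b) semigroup_with_zero_scheme \<Rightarrow> (nat \<Rightarrow> nat \<Rightarrow> 'a) semigroup_with_zero" where
  "rook_matrices S =
     \<lparr>carrier = {A. (\<forall>i j. A i j \<in> carrier S) \<and> finite {(i, j). A i j \<noteq> sg_zero S} \<and>
         (\<forall>i j k. j \<noteq> k \<longrightarrow> sg_inv S (A i j) \<cdot>\<^bsub>S\<^esub> A i k = sg_zero S) \<and>
         (\<forall>i k j. i \<noteq> k \<longrightarrow> A i j \<cdot>\<^bsub>S\<^esub> sg_inv S (A k j) = sg_zero S)},
      sg_mult = (\<lambda>A B i j. \<Squnion>\<^bsub>natural_order S\<^esub> (range (\<lambda>k. A i k \<cdot>\<^bsub>S\<^esub> B k j))),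
      sg_zero = (\<lambda>i j. sg_zero S)\<rparr>"

text \<open>
  Since \<open>e'\<close> ranges over the class \<open>P\<close> of \<open>e\<close> and \<open>f'\<close> over the class \<open>Q\<close> of \<open>f\<close>, the
  multiplication is \<open>[e] + [f] = [e' \<or> f']\<close> for orthogonal \<open>e'\<close> and \<open>f'\<close>; the definite
  description is meaningful because this class does not depend on the choice of \<open>e'\<close> and \<open>f'\<close>.
\<close>

definition type_monoid ::
    "('a, 'b) semigroup_with_zero_scheme \<Rightarrow> (nat \<Rightarrow> nat \<Rightarrow> 'a) set monoid" where
  "type_monoid S = (let M = rook_matrices S in
     \<lparr>carrier = idempotents M // D_relation M,
      mult = (\<lambda>P Q. THE R. \<exists>e' \<in> P. \<exists>f' \<in> Q. orthogonal M e' f' \<and>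
                 R = D_relation M `` {e' \<squnion>\<^bsub>natural_order M\<^esub> f'}),
      one = D_relation M `` {sg_zero M}\<rparr>)"

definition free_abelian_monoid :: "'x set \<Rightarrow> 'x multiset monoid" where
  "free_abelian_monoid X = \<lparr>carrier = {A. set_mset A \<subseteq> X}, mult = (+), one = {#}\<rparr>"

text \<open>
  The relation \<open>\<cong>\<close> of \<open>HOL-Algebra\<close> asks for a bijection that respects multiplication;
  between monoids such a bijection automatically sends the unit to the unit.
\<close>

end

theory Submission
  imports Defs
begin

text \<open>
  Let \<open>M\<close> be the semigroup of rook matrices over \<open>S\<close>. It is an inverse semigroup whose
  idempotents are the diagonal matrices with finitely many non-zero entries, all idempotent. It
  inherits from \<open>S\<close> what the argument needs: orthogonal elements have joins over which
  multiplication distributes, and idempotents have relative complements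
  (\<open>M_orthogonally_boolean\<close>). In any such semigroup, if \<open>a\<close> leads from \<open>e\<close> to \<open>e'\<close> and \<open>b\<close>
  leads from \<open>f\<close> to \<open>f'\<close>, with \<open>e\<close> orthogonal to \<open>f\<close> and \<open>e'\<close> to \<open>f'\<close>, then the join of
  \<open>a\<close> and \<open>b\<close> leads from the join of \<open>e\<close> and \<open>f\<close> to that of \<open>e'\<close> and \<open>f'\<close>. Hence addition
  of \<open>D\<close>-classes is well defined (\<open>D_class_mult\<close>).

  Suppose that the type monoid is free. The size of multisets is then an additive length function
  on the idempotents of \<open>M\<close> that vanishes only at zero. An idempotent that is neither zero nor an
  atom splits into two complementary parts of smaller length, and the idempotents below it are
  the joins of those below the two parts; by induction every down-set of idempotents is finite
  (\<open>finite_downset_if_length\<close>).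

  Suppose conversely that these down-sets are finite. Assign to an idempotent \<open>e\<close> the multiset of
  the \<open>D\<close>-classes of the atoms below \<open>e\<close>. It depends on the class of \<open>e\<close> only, since
  conjugation matches the atoms below \<open>D\<close>-related idempotents (\<open>atom_classes_D_invariant\<close>),
  and it is additive, since an atom below an orthogonal join lies below exactly one of the
  summands (\<open>atoms_below_join\<close>). It is onto all multisets of classes of atoms, because any two
  idempotents of \<open>M\<close> have orthogonal copies (\<open>M_orthogonally_separating\<close>), and it separates
  classes, because \<open>D\<close>-related atoms can be split off one pair at a time
  (\<open>D_if_atom_classes_eq\<close>). So the type monoid is free on the set of classes of atoms, which is
  not empty because \<open>S\<close> has a non-zero element.

  Finally, the down-sets of idempotents of \<open>M\<close> are finite exactly if those of all elements of
  \<open>S\<close> are (\<open>M_semisimple_iff\<close>).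
\<close>

section \<open>Inverse semigroups and the natural partial order\<close>

context inverse_semigroup
begin

declare sg_closed [simp] sg_assoc [simp]

abbreviation star :: "'a \<Rightarrow> 'a" (\<open>_\<^sup>\<star>\<close> [1000] 1000) where "a\<^sup>\<star> \<equiv> sg_inv S a"

abbreviation E :: "'a set" where "E \<equiv> idempotents S"

abbreviation leq :: "'a \<Rightarrow> 'a \<Rightarrow> bool" (infix \<open>\<preceq>\<close> 50)
  where "a \<preceq> b \<equiv> a \<sqsubseteq>\<^bsub>natural_order S\<^esub> b"

abbreviation is_lub :: "'a set \<Rightarrow> 'a \<Rightarrow> bool"
  where "is_lub A s \<equiv> least (natural_order S) s (Upper (natural_order S) A)"

lemma star_props:
  assumes "a \<in> carrier S"
  shows "a\<^sup>\<star> \<in> carrier S \<and> a \<cdot> a\<^sup>\<star> \<cdot> a = a \<and> a\<^sup>\<star> \<cdot> a \<cdot> a\<^sup>\<star> = a\<^sup>\<star>"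
  unfolding sg_inv_def by (rule theI') (rule ex1_inverse[OF assms])

lemma star_closed [simp]: "a \<in> carrier S \<Longrightarrow> a\<^sup>\<star> \<in> carrier S"
  using star_props by blast

lemma star_regular [simp]: "a \<in> carrier S \<Longrightarrow> a \<cdot> (a\<^sup>\<star> \<cdot> a) = a"
  using star_props by fastforce

lemma star_regular' [simp]: "a \<in> carrier S \<Longrightarrow> a\<^sup>\<star> \<cdot> (a \<cdot> a\<^sup>\<star>) = a\<^sup>\<star>"
  using star_props by fastforce

lemma star_regular_left [simp]:
  "\<lbrakk>a \<in> carrier S; x \<in> carrier S\<rbrakk> \<Longrightarrow> a \<cdot> (a\<^sup>\<star> \<cdot> (a \<cdot> x)) = a \<cdot> x"
  by (metis sg_assoc sg_closed star_closed star_regular)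

lemma star_regular_left' [simp]:
  "\<lbrakk>a \<in> carrier S; x \<in> carrier S\<rbrakk> \<Longrightarrow> a\<^sup>\<star> \<cdot> (a \<cdot> (a\<^sup>\<star> \<cdot> x)) = a\<^sup>\<star> \<cdot> x"
  by (metis sg_assoc sg_closed star_closed star_regular')

lemma star_unique:
  "\<lbrakk>a \<in> carrier S; b \<in> carrier S; a \<cdot> (b \<cdot> a) = a; b \<cdot> (a \<cdot> b) = b\<rbrakk> \<Longrightarrow> a\<^sup>\<star> = b"
  using ex1_inverse[of a] star_props[of a] by (metis sg_assoc)

lemma star_star [simp]: "a \<in> carrier S \<Longrightarrow> a\<^sup>\<star>\<^sup>\<star> = a"
  by (rule star_unique) auto

lemma idem_closed [simp]: "e \<in> E \<Longrightarrow> e \<in> carrier S"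
  by (simp add: idempotents_def)

lemma idem_idem [simp]: "e \<in> E \<Longrightarrow> e \<cdot> e = e"
  unfolding idempotents_def by blast

lemma idem_idem_left [simp]: "\<lbrakk>e \<in> E; x \<in> carrier S\<rbrakk> \<Longrightarrow> e \<cdot> (e \<cdot> x) = e \<cdot> x"
  by (simp flip: sg_assoc)

lemma idemI: "\<lbrakk>e \<in> carrier S; e \<cdot> e = e\<rbrakk> \<Longrightarrow> e \<in> E"
  unfolding idempotents_def by blast

lemma star_idem [simp]: "e \<in> E \<Longrightarrow> e\<^sup>\<star> = e"
  by (rule star_unique) auto

text \<open>
  If \<open>x\<close> is the inverse of \<open>e \<cdot> f\<close>, then \<open>f \<cdot> x \<cdot> e\<close> is an idempotent and is also an inverse
  of \<open>e \<cdot> f\<close>. By uniqueness \<open>x\<close> is idempotent, and an idempotent is its own inverse.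
\<close>

lemma idem_mult_closed [simp]:
  assumes e: "e \<in> E" and f: "f \<in> E"
  shows "e \<cdot> f \<in> E"
proof -
  define x where "x = (e \<cdot> f)\<^sup>\<star>"
  have [simp]: "e \<in> carrier S" "f \<in> carrier S" "x \<in> carrier S"
    using e f by (auto simp: x_def)
  have 1: "e \<cdot> (f \<cdot> (x \<cdot> (e \<cdot> f))) = e \<cdot> f"
    using star_regular[of "e \<cdot> f", folded x_def] by simp
  have 2: "x \<cdot> (e \<cdot> (f \<cdot> x)) = x"
    using star_regular'[of "e \<cdot> f", folded x_def] by simp
  have 3: "x \<cdot> (e \<cdot> (f \<cdot> (x \<cdot> e))) = x \<cdot> e"
    using arg_cong[OF 2, of "\<lambda>y. y \<cdot> e"] by simp
  have "(e \<cdot> f)\<^sup>\<star> = f \<cdot> (x \<cdot> e)"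
    by (rule star_unique) (simp_all add: e f 1 3)
  then have x: "x = f \<cdot> (x \<cdot> e)" by (simp only: x_def)
  have "x \<cdot> x = f \<cdot> (x \<cdot> e) \<cdot> (f \<cdot> (x \<cdot> e))" by (rule arg_cong2[OF x x])
  also have "\<dots> = f \<cdot> (x \<cdot> e)" by (simp add: f 3)
  also note x[symmetric]
  finally have "x \<in> E" by (simp add: idemI)
  moreover have "x\<^sup>\<star> = e \<cdot> f" unfolding x_def by (rule star_star) simp
  ultimately show ?thesis using star_idem[of x] by argo
qed

text \<open>
  Both \<open>f \<cdot> e\<close> and the idempotent \<open>e \<cdot> f\<close> itself are inverses of \<open>e \<cdot> f\<close>.
\<close>

lemma idem_commute:
  assumes e: "e \<in> E" and f: "f \<in> E"
  shows "e \<cdot> f = f \<cdot> e"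
proof -
  have "e \<cdot> f \<cdot> (e \<cdot> f) = e \<cdot> f" "f \<cdot> e \<cdot> (f \<cdot> e) = f \<cdot> e"
    by (rule idem_idem, simp add: e f)+
  then have "(e \<cdot> f)\<^sup>\<star> = f \<cdot> e"
    by (intro star_unique) (simp_all add: e f del: idem_idem)
  moreover have "(e \<cdot> f)\<^sup>\<star> = e \<cdot> f"
    by (rule star_idem) (simp add: e f)
  ultimately show ?thesis by simp
qed

lemma idem_left_commute:
  "\<lbrakk>e \<in> E; f \<in> E; x \<in> carrier S\<rbrakk> \<Longrightarrow> e \<cdot> (f \<cdot> x) = f \<cdot> (e \<cdot> x)"
  by (metis idem_closed idem_commute sg_assoc)

lemma domain_idem [simp]: "a \<in> carrier S \<Longrightarrow> a\<^sup>\<star> \<cdot> a \<in> E"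
  by (rule idemI) auto

lemma range_idem [simp]: "a \<in> carrier S \<Longrightarrow> a \<cdot> a\<^sup>\<star> \<in> E"
  by (rule idemI) auto

lemma star_mult [simp]:
  assumes [simp]: "a \<in> carrier S" "b \<in> carrier S"
  shows "(a \<cdot> b)\<^sup>\<star> = b\<^sup>\<star> \<cdot> a\<^sup>\<star>"
proof (rule star_unique)
  have *: "b \<cdot> (b\<^sup>\<star> \<cdot> (a\<^sup>\<star> \<cdot> (a \<cdot> x))) = a\<^sup>\<star> \<cdot> (a \<cdot> (b \<cdot> (b\<^sup>\<star> \<cdot> x)))" if "x \<in> carrier S" for x
    using idem_left_commute[of "b \<cdot> b\<^sup>\<star>" "a\<^sup>\<star> \<cdot> a" x] that by simp
  show "a \<cdot> b \<cdot> (b\<^sup>\<star> \<cdot> a\<^sup>\<star> \<cdot> (a \<cdot> b)) = a \<cdot> b" by (simp add: *)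
  show "b\<^sup>\<star> \<cdot> a\<^sup>\<star> \<cdot> (a \<cdot> b \<cdot> (b\<^sup>\<star> \<cdot> a\<^sup>\<star>)) = b\<^sup>\<star> \<cdot> a\<^sup>\<star>"
    by (simp flip: *)
qed auto

lemma conj_idem [simp]:
  assumes [simp]: "a \<in> carrier S" and e: "e \<in> E"
  shows "a \<cdot> (e \<cdot> a\<^sup>\<star>) \<in> E"
proof (rule idemI)
  show "a \<cdot> (e \<cdot> a\<^sup>\<star>) \<cdot> (a \<cdot> (e \<cdot> a\<^sup>\<star>)) = a \<cdot> (e \<cdot> a\<^sup>\<star>)"
    using idem_left_commute[of "a\<^sup>\<star> \<cdot> a" e "a\<^sup>\<star>"] e by simp
qed (use e in auto)

lemma conj_idem' [simp]:
  "\<lbrakk>a \<in> carrier S; e \<in> E\<rbrakk> \<Longrightarrow> a\<^sup>\<star> \<cdot> (e \<cdot> a) \<in> E"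
  using conj_idem[of "a\<^sup>\<star>" e] by simp

lemma leq_iff: "a \<preceq> b \<longleftrightarrow> a = b \<cdot> (a\<^sup>\<star> \<cdot> a)"
  by (simp add: natural_order_def)

lemma carrier_natural_order [simp]: "carrier (natural_order S) = carrier S"
  by (simp add: natural_order_def)

lemma eq_natural_order: "(.=\<^bsub>natural_order S\<^esub>) = (=)"
  by (simp add: natural_order_def)

text \<open>
  The natural order may be witnessed by any idempotent, on either side. All monotonicity
  properties come from moving the witness from one side to the other.
\<close>

lemma leqI_right:
  assumes [simp]: "b \<in> carrier S" "e \<in> E" and a: "a = b \<cdot> e"
  shows "a \<preceq> b"
proof -
  have "b \<cdot> (e \<cdot> (b\<^sup>\<star> \<cdot> (b \<cdot> e))) = b \<cdot> e"
    using idem_left_commute[of e "b\<^sup>\<star> \<cdot> b" e] by simp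
  then show ?thesis by (simp add: leq_iff a)
qed

lemma leqI_left:
  assumes [simp]: "b \<in> carrier S" "e \<in> E" and a: "a = e \<cdot> b"
  shows "a \<preceq> b"
proof (rule leqI_right)
  show "a = b \<cdot> (b\<^sup>\<star> \<cdot> (e \<cdot> b))"
    using idem_left_commute[of "b \<cdot> b\<^sup>\<star>" e b] by (simp add: a)
qed auto

lemma leq_rightE:
  assumes "a \<preceq> b" "a \<in> carrier S"
  obtains e where "e \<in> E" "a = b \<cdot> e"
  using assms leq_iff by (metis domain_idem)

lemma leq_leftE:
  assumes "a \<preceq> b" and [simp]: "a \<in> carrier S" "b \<in> carrier S"
  obtains e where "e \<in> E" "a = e \<cdot> b"
proof -
  obtain e where e: "e \<in> E" "a = b \<cdot> e" using assms leq_rightE by metis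
  have "a = b \<cdot> (e \<cdot> b\<^sup>\<star>) \<cdot> b"
    using e idem_commute[of e "b\<^sup>\<star> \<cdot> b"] by simp
  then show thesis using e that[of "b \<cdot> (e \<cdot> b\<^sup>\<star>)"] by simp
qed

lemma leq_refl [simp]: "a \<in> carrier S \<Longrightarrow> a \<preceq> a"
  by (simp add: leq_iff)

lemma leq_trans:
  assumes "a \<preceq> b" "b \<preceq> c" and [simp]: "a \<in> carrier S" "b \<in> carrier S" "c \<in> carrier S"
  shows "a \<preceq> c"
proof -
  obtain e where e: "e \<in> E" "a = b \<cdot> e" using assms leq_rightE by metis
  obtain f where f: "f \<in> E" "b = c \<cdot> f" using assms leq_rightE by metis
  show ?thesis by (rule leqI_right[of c "f \<cdot> e"]) (use e f in auto)
qed

lemma leq_antisym: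
  assumes ab: "a \<preceq> b" and ba: "b \<preceq> a" and [simp]: "a \<in> carrier S" "b \<in> carrier S"
  shows "a = b"
proof -
  have a: "a = b \<cdot> (a\<^sup>\<star> \<cdot> a)" and b: "b = a \<cdot> (b\<^sup>\<star> \<cdot> b)"
    using ab ba leq_iff by blast+
  have "a\<^sup>\<star> \<cdot> a = (b\<^sup>\<star> \<cdot> b) \<cdot> (a\<^sup>\<star> \<cdot> a)"
    using arg_cong[OF a, of "\<lambda>x. a\<^sup>\<star> \<cdot> a \<cdot> (x\<^sup>\<star> \<cdot> x)"]
    idem_left_commute[of "a\<^sup>\<star> \<cdot> a" "b\<^sup>\<star> \<cdot> b" "a\<^sup>\<star> \<cdot> a"] by simp
  moreover have "b\<^sup>\<star> \<cdot> b = (a\<^sup>\<star> \<cdot> a) \<cdot> (b\<^sup>\<star> \<cdot> b)"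
    using arg_cong[OF b, of "\<lambda>x. b\<^sup>\<star> \<cdot> b \<cdot> (x\<^sup>\<star> \<cdot> x)"]
    idem_left_commute[of "b\<^sup>\<star> \<cdot> b" "a\<^sup>\<star> \<cdot> a" "b\<^sup>\<star> \<cdot> b"] by simp
  ultimately have "a\<^sup>\<star> \<cdot> a = b\<^sup>\<star> \<cdot> b"
    by (metis assms(3,4) domain_idem idem_commute)
  then show ?thesis using a by simp
qed

lemma partial_order_natural_order: "partial_order (natural_order S)"
  by unfold_locales
    (auto simp: eq_natural_order intro: leq_antisym leq_trans)

lemma mult_left_mono:
  assumes "a \<preceq> b" and [simp]: "a \<in> carrier S" "b \<in> carrier S" "c \<in> carrier S"
  shows "c \<cdot> a \<preceq> c \<cdot> b"
  using leq_rightE[OF assms(1,2)] by (metis assms(3,4) idem_closed leqI_right sg_assoc sg_closed)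

lemma mult_right_mono:
  assumes "a \<preceq> b" and [simp]: "a \<in> carrier S" "b \<in> carrier S" "c \<in> carrier S"
  shows "a \<cdot> c \<preceq> b \<cdot> c"
  using leq_leftE[OF assms(1-3)] by (metis assms(3,4) idem_closed leqI_left sg_assoc sg_closed)

lemma star_mono:
  assumes "a \<preceq> b" and [simp]: "a \<in> carrier S" "b \<in> carrier S"
  shows "a\<^sup>\<star> \<preceq> b\<^sup>\<star>"
proof -
  obtain e where e: "e \<in> E" "a = b \<cdot> e" using assms leq_rightE by metis
  show ?thesis by (rule leqI_left[of _ e]) (use e in auto)
qed

lemma idem_leq_iff:
  assumes [simp]: "e \<in> E" "f \<in> E"
  shows "f \<preceq> e \<longleftrightarrow> f = e \<cdot> f"
  by (simp add: leq_iff)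

lemma leq_idem_imp_idem:
  assumes "a \<preceq> e" "a \<in> carrier S" and [simp]: "e \<in> E"
  shows "a \<in> E"
  using leq_rightE[OF assms(1,2)] by (metis assms(3) idem_mult_closed)

lemma is_lub_iff:
  assumes "A \<subseteq> carrier S"
  shows "is_lub A s \<longleftrightarrow> s \<in> carrier S \<and> (\<forall>x\<in>A. x \<preceq> s) \<and>
     (\<forall>u\<in>carrier S. (\<forall>x\<in>A. x \<preceq> u) \<longrightarrow> s \<preceq> u)"
  using assms unfolding least_def Upper_def carrier_natural_order by blast

lemma is_lub_unique:
  assumes "is_lub A s" "is_lub A t"
  shows "s = t"
  using partial_order.least_unique[OF partial_order_natural_order] assms by blast

lemma Sup_eqI: "is_lub A s \<Longrightarrow> \<Squnion>\<^bsub>natural_order S\<^esub> A = s"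
  unfolding sup_def by (metis (mono_tags, lifting) is_lub_unique someI)

lemma is_lub_closed: "is_lub A s \<Longrightarrow> s \<in> carrier S"
  by (auto simp: least_def Upper_def)

lemma is_lub_star:
  assumes "is_lub A s" and A: "A \<subseteq> carrier S"
  shows "is_lub ((\<lambda>x. x\<^sup>\<star>) ` A) (s\<^sup>\<star>)"
proof -
  have [simp]: "s \<in> carrier S" using assms is_lub_closed by blast
  have *: "(\<lambda>x. x\<^sup>\<star>) ` A \<subseteq> carrier S" using A by auto
  have "s\<^sup>\<star> \<preceq> u" if u: "u \<in> carrier S" "\<forall>x\<in>A. x\<^sup>\<star> \<preceq> u" for u
  proof -
    have "\<forall>x\<in>A. x \<preceq> u\<^sup>\<star>"
      using u A by (metis star_mono star_closed star_star subsetD)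
    then have "s \<preceq> u\<^sup>\<star>" using assms(1) u by (auto simp: is_lub_iff[OF A])
    then show ?thesis using u star_mono[of s "u\<^sup>\<star>"] by simp
  qed
  then show ?thesis
    using assms(1) A unfolding is_lub_iff[OF *] is_lub_iff[OF A] by (auto intro!: star_mono)
qed

text \<open>
  Suprema can be taken in stages. This turns associativity and distributivity of matrix
  multiplication into the remark that two double joins range over the same set.
\<close>

lemma is_lub_UNION:
  assumes "\<And>i. i \<in> I \<Longrightarrow> is_lub (A i) (s i)" "\<And>i. i \<in> I \<Longrightarrow> A i \<subseteq> carrier S"
  shows "is_lub (\<Union>i\<in>I. A i) t \<longleftrightarrow> is_lub (s ` I) t"
proof -
  have s: "s i \<in> carrier S" if "i \<in> I" for i using assms(1)[OF that] by (rule is_lub_closed)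
  have "(\<forall>x\<in>A i. x \<preceq> u) \<longleftrightarrow> s i \<preceq> u" if u: "u \<in> carrier S" and i: "i \<in> I" for u i
  proof -
    have ub: "\<forall>x\<in>A i. x \<preceq> s i" and least: "(\<forall>x\<in>A i. x \<preceq> u) \<longrightarrow> s i \<preceq> u"
      using assms(1)[OF i] u unfolding is_lub_iff[OF assms(2)[OF i]] by blast+
    have "x \<preceq> u" if "x \<in> A i" "s i \<preceq> u" for x
      using leq_trans[OF bspec[OF ub that(1)] that(2)] assms(2)[OF i] s[OF i] u that(1) by blast
    then show ?thesis using least by blast
  qed
  then have *: "(\<forall>x\<in>(\<Union>i\<in>I. A i). x \<preceq> u) \<longleftrightarrow> (\<forall>x\<in>s ` I. x \<preceq> u)" if "u \<in> carrier S" for u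
    using that by blast
  have Upper_eq: "Upper (natural_order S) B = {u \<in> carrier S. \<forall>x\<in>B. x \<preceq> u}"
    if "B \<subseteq> carrier S" for B
    using that unfolding Upper_def carrier_natural_order by blast
  have sub: "(\<Union>i\<in>I. A i) \<subseteq> carrier S" "s ` I \<subseteq> carrier S" using assms(2) s by blast+
  have "Upper (natural_order S) (\<Union>i\<in>I. A i) = Upper (natural_order S) (s ` I)"
    unfolding sub[THEN Upper_eq] by (rule Collect_cong) (rule conj_cong[OF refl *])
  then show ?thesis by simp
qed

end

section \<open>Inverse semigroups from an involution\<close>

text \<open>
  Rook matrices come with an obvious candidate for the inverse, but the uniqueness of inverses
  is not obvious. It suffices that the projections \<open>a \<cdot> star a\<close> commute: then all idempotents
  are projections, so all idempotents commute, and this forces inverses to be unique.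
\<close>

lemma inverse_semigroup_from_involution:
  fixes S (structure) and star :: "'a \<Rightarrow> 'a"
  assumes closed [simp]: "\<And>a b. \<lbrakk>a \<in> carrier S; b \<in> carrier S\<rbrakk> \<Longrightarrow> a \<cdot> b \<in> carrier S"
    and assoc: "\<And>a b c. \<lbrakk>a \<in> carrier S; b \<in> carrier S; c \<in> carrier S\<rbrakk>
                  \<Longrightarrow> a \<cdot> b \<cdot> c = a \<cdot> (b \<cdot> c)"
    and star_closed [simp]: "\<And>a. a \<in> carrier S \<Longrightarrow> star a \<in> carrier S"
    and star_star: "\<And>a. a \<in> carrier S \<Longrightarrow> star (star a) = a"
    and star_mult: "\<And>a b. \<lbrakk>a \<in> carrier S; b \<in> carrier S\<rbrakk> \<Longrightarrow> star (a \<cdot> b) = star b \<cdot> star a"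
    and regular: "\<And>a. a \<in> carrier S \<Longrightarrow> a \<cdot> star a \<cdot> a = a"
    and projections_commute: "\<And>a b. \<lbrakk>a \<in> carrier S; b \<in> carrier S\<rbrakk>
      \<Longrightarrow> a \<cdot> star a \<cdot> (b \<cdot> star b) = b \<cdot> star b \<cdot> (a \<cdot> star a)"
  shows "inverse_semigroup S"
    and "a \<in> carrier S \<Longrightarrow> sg_inv S a = star a"
    and "\<lbrakk>a \<in> carrier S; a \<cdot> a = a\<rbrakk> \<Longrightarrow> a \<cdot> star a = a"
proof -
  have regular': "star a \<cdot> a \<cdot> star a = star a" if "a \<in> carrier S" for a
    using regular[of "star a"] star_star that by simp
  \<comment> \<open>An idempotent \<open>a\<close> is a projection, because \<open>star a = star a \<cdot> a \<cdot> a \<cdot> star a\<close>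
    is a product of two commuting projections.\<close>
  have self_adjoint: "star a = a" if [simp]: "a \<in> carrier S" and idem: "a \<cdot> a = a" for a
  proof -
    have ss: "star a \<cdot> star a = star a"
      using star_mult[of a a] idem by simp
    have "star a = star a \<cdot> (a \<cdot> a) \<cdot> star a" using regular'[of a] idem by simp
    also have "\<dots> = star a \<cdot> star (star a) \<cdot> (a \<cdot> star a)" by (simp add: assoc star_star)
    also have "\<dots> = a \<cdot> star a \<cdot> (star a \<cdot> star (star a))" by (rule projections_commute) auto
    also have "\<dots> = a \<cdot> (star a \<cdot> star a) \<cdot> a" by (simp add: assoc star_star)
    also have "\<dots> = a" by (simp add: ss regular)
    finally show ?thesis .
  qed
  then show "a \<cdot> star a = a" if "a \<in> carrier S" "a \<cdot> a = a"
    using that by simp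
  have commute: "e \<cdot> f = f \<cdot> e"
    if "e \<in> carrier S" "e \<cdot> e = e" "f \<in> carrier S" "f \<cdot> f = f" for e f
    using projections_commute[of e f] self_adjoint that by simp
  have unique: "b = c"
    if [simp]: "a \<in> carrier S" "b \<in> carrier S" "c \<in> carrier S"
      and b: "a \<cdot> b \<cdot> a = a" "b \<cdot> a \<cdot> b = b" and c: "a \<cdot> c \<cdot> a = a" "c \<cdot> a \<cdot> c = c" for a b c
  proof -
    have ba: "b \<cdot> a \<cdot> (b \<cdot> a) = b \<cdot> a" and ca: "c \<cdot> a \<cdot> (c \<cdot> a) = c \<cdot> a"
      and ab: "a \<cdot> b \<cdot> (a \<cdot> b) = a \<cdot> b" and ac: "a \<cdot> c \<cdot> (a \<cdot> c) = a \<cdot> c"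
      using b c by (simp_all add: assoc)
    have "b = b \<cdot> (a \<cdot> c \<cdot> a) \<cdot> b" using b c by simp
    also have "\<dots> = b \<cdot> a \<cdot> (c \<cdot> a) \<cdot> b" by (simp add: assoc)
    also have "\<dots> = c \<cdot> a \<cdot> (b \<cdot> a) \<cdot> b" using commute[OF _ ba _ ca] by simp
    also have "\<dots> = c \<cdot> a \<cdot> (b \<cdot> a \<cdot> b)" by (simp add: assoc)
    also have "\<dots> = c \<cdot> a \<cdot> b" using b by simp
    finally have 1: "b = c \<cdot> a \<cdot> b" .
    have "c = c \<cdot> (a \<cdot> b \<cdot> a) \<cdot> c" using b c by simp
    also have "\<dots> = c \<cdot> (a \<cdot> b \<cdot> (a \<cdot> c))" by (simp add: assoc)
    also have "\<dots> = c \<cdot> (a \<cdot> c \<cdot> (a \<cdot> b))" using commute[OF _ ab _ ac] by simp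
    also have "\<dots> = c \<cdot> a \<cdot> c \<cdot> (a \<cdot> b)" by (simp add: assoc)
    also have "\<dots> = c \<cdot> a \<cdot> b" using c by (simp add: assoc)
    finally show ?thesis using 1 by simp
  qed
  show "inverse_semigroup S"
  proof
    fix a assume [simp]: "a \<in> carrier S"
    show "\<exists>!b. b \<in> carrier S \<and> a \<cdot> b \<cdot> a = a \<and> b \<cdot> a \<cdot> b = b"
      by (rule ex1I[of _ "star a"]) (simp add: regular regular', rule unique[of a], simp_all add: regular regular')
  qed (simp_all add: assoc)
  show "sg_inv S a = star a" if "a \<in> carrier S"
    unfolding sg_inv_def
    by (rule the_equality) (simp add: that regular regular', rule unique[of a], simp_all add: that regular regular')
qed

section \<open>Orthogonality and orthogonal joins\<close>

context inverse_semigroup_with_zero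
begin

notation sg_zero (\<open>\<zero>\<index>\<close>)

declare zero_closed [simp] zero_left [simp] zero_right [simp]

lemma zero_idem [simp]: "\<zero> \<in> E"
  by (simp add: idemI)

lemma zero_leq [simp]: "a \<in> carrier S \<Longrightarrow> \<zero> \<preceq> a"
  by (simp add: leq_iff)

lemma leq_zero_iff [simp]: "a \<in> carrier S \<Longrightarrow> a \<preceq> \<zero> \<longleftrightarrow> a = \<zero>"
  using leq_antisym by auto

lemma star_eq_zero_iff [simp]: "a \<in> carrier S \<Longrightarrow> a\<^sup>\<star> = \<zero> \<longleftrightarrow> a = \<zero>"
  by (metis star_idem star_star zero_idem)

lemma is_lub_zero:
  assumes "A \<subseteq> {\<zero>}"
  shows "is_lub A s \<longleftrightarrow> s = \<zero>"
proof -
  have sub: "A \<subseteq> carrier S" using assms by auto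
  have "is_lub A \<zero>" using assms unfolding is_lub_iff[OF sub] by auto
  then show ?thesis using is_lub_unique by blast
qed

lemma is_lub_singleton: "a \<in> carrier S \<Longrightarrow> is_lub {a} s \<longleftrightarrow> s = a"
  by (subst is_lub_iff) (auto intro: leq_antisym)

lemma is_lub_pair_zero:
  assumes "a \<in> carrier S"
  shows "is_lub {a, \<zero>} s \<longleftrightarrow> s = a" "is_lub {\<zero>, a} s \<longleftrightarrow> s = a"
  by (use assms in \<open>subst is_lub_iff; auto intro: leq_antisym\<close>)+

lemma orthogonal_sym: "\<lbrakk>orthogonal S a b; a \<in> carrier S; b \<in> carrier S\<rbrakk> \<Longrightarrow> orthogonal S b a"
  unfolding orthogonal_def by (metis star_closed star_eq_zero_iff star_mult star_star sg_closed)

lemma orthogonal_idem_iff: "\<lbrakk>e \<in> E; f \<in> E\<rbrakk> \<Longrightarrow> orthogonal S e f \<longleftrightarrow> e \<cdot> f = \<zero>"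
  by (simp add: orthogonal_def)

text \<open>
  An idempotent inserted between disjoint elements can be moved out, because it commutes with
  the range idempotent of \<open>a\<close>.
\<close>

lemma disjoint_conj:
  assumes [simp]: "a \<in> carrier S" "b \<in> carrier S" "e \<in> E" and ab: "a\<^sup>\<star> \<cdot> b = \<zero>"
  shows "a\<^sup>\<star> \<cdot> (e \<cdot> b) = \<zero>"
proof -
  have "a\<^sup>\<star> \<cdot> (e \<cdot> b) = a\<^sup>\<star> \<cdot> (a \<cdot> a\<^sup>\<star> \<cdot> (e \<cdot> b))" by simp
  also have "\<dots> = a\<^sup>\<star> \<cdot> (e \<cdot> (a \<cdot> a\<^sup>\<star> \<cdot> b))"
    by (subst idem_left_commute) auto
  also have "\<dots> = \<zero>" using ab by simp
  finally show ?thesis .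
qed

lemma orthogonal_mult_left:
  assumes "orthogonal S a b" and [simp]: "a \<in> carrier S" "b \<in> carrier S" "c \<in> carrier S"
  shows "orthogonal S (c \<cdot> a) (c \<cdot> b)"
proof -
  have "a\<^sup>\<star> \<cdot> (c\<^sup>\<star> \<cdot> (c \<cdot> b)) = \<zero>"
    using disjoint_conj[of a b "c\<^sup>\<star> \<cdot> c"] assms by (simp add: orthogonal_def)
  moreover have "c \<cdot> (a \<cdot> (b\<^sup>\<star> \<cdot> c\<^sup>\<star>)) = c \<cdot> ((a \<cdot> b\<^sup>\<star>) \<cdot> c\<^sup>\<star>)" by simp
  moreover have "\<dots> = \<zero>" using assms(1) by (simp add: orthogonal_def del: sg_assoc)
  ultimately show ?thesis by (simp add: orthogonal_def)
qed

end

text \<open>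
  These are the consequences of being Boolean that the argument uses. They pass from \<open>S\<close> to its
  rook matrices more directly than the full definition does: only orthogonal joins have to be
  computed for matrices, and these are entrywise. Distributivity on the right follows from
  distributivity on the left by applying the inverse.
\<close>

locale orthogonally_boolean_semigroup = inverse_semigroup_with_zero +
  assumes orthogonal_join_exists:
    "\<lbrakk>a \<in> carrier S; b \<in> carrier S; orthogonal S a b\<rbrakk> \<Longrightarrow> \<exists>s. is_lub {a, b} s"
    and orthogonal_distrib_left:
    "\<lbrakk>a \<in> carrier S; b \<in> carrier S; c \<in> carrier S; orthogonal S a b; is_lub {a, b} s\<rbrakk>
       \<Longrightarrow> is_lub {c \<cdot> a, c \<cdot> b} (c \<cdot> s)"
    and relative_complement:
    "\<lbrakk>e \<in> E; f \<in> E; f \<preceq> e\<rbrakk> \<Longrightarrow> \<exists>g\<in>E. f \<cdot> g = \<zero>\<^bsub>S\<^esub> \<and> is_lub {f, g} e"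
begin

lemma orthogonal_distrib_right:
  assumes [simp]: "a \<in> carrier S" "b \<in> carrier S" "c \<in> carrier S"
    and ab: "orthogonal S a b" "is_lub {a, b} s"
  shows "is_lub {a \<cdot> c, b \<cdot> c} (s \<cdot> c)"
proof -
  have [simp]: "s \<in> carrier S" using ab is_lub_closed by blast
  have "is_lub {a\<^sup>\<star>, b\<^sup>\<star>} (s\<^sup>\<star>)" using is_lub_star[OF ab(2)] by simp
  then have "is_lub {c\<^sup>\<star> \<cdot> a\<^sup>\<star>, c\<^sup>\<star> \<cdot> b\<^sup>\<star>} (c\<^sup>\<star> \<cdot> s\<^sup>\<star>)"
    using orthogonal_distrib_left[of "a\<^sup>\<star>" "b\<^sup>\<star>" "c\<^sup>\<star>" "s\<^sup>\<star>"] ab(1)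
      orthogonal_sym[OF ab(1)]
    by (auto simp: orthogonal_def)
  from is_lub_star[OF this] show ?thesis by simp
qed

lemma orthogonal_join:
  assumes abc [simp]: "a \<in> carrier S" "b \<in> carrier S" "c \<in> carrier S"
    and ab: "orthogonal S a b" "is_lub {a, b} s"
    and ac: "orthogonal S c a" and bc: "orthogonal S c b"
  shows "orthogonal S c s"
proof -
  have [simp]: "s \<in> carrier S" using ab is_lub_closed by blast
  have "is_lub {c\<^sup>\<star> \<cdot> a, c\<^sup>\<star> \<cdot> b} (c\<^sup>\<star> \<cdot> s)"
    using orthogonal_distrib_left ab by simp
  then have 1: "c\<^sup>\<star> \<cdot> s = \<zero>" using ac bc by (simp add: orthogonal_def is_lub_zero)
  have "is_lub {a \<cdot> c\<^sup>\<star>, b \<cdot> c\<^sup>\<star>} (s \<cdot> c\<^sup>\<star>)"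
    using orthogonal_distrib_right ab by simp
  then have "s \<cdot> c\<^sup>\<star> = \<zero>"
    using orthogonal_sym[OF ac] orthogonal_sym[OF bc] by (simp add: orthogonal_def is_lub_zero)
  then have "c \<cdot> s\<^sup>\<star> = \<zero>"
    using star_mult[of s "c\<^sup>\<star>"] by (metis star_idem star_star abc(3) star_closed zero_idem \<open>s \<in> carrier S\<close>)
  with 1 show ?thesis by (simp add: orthogonal_def)
qed

text \<open>
  The last property, that an element orthogonal to every member of \<open>F\<close> is orthogonal to the join,
  makes the induction work: it provides the join of a new element with the join so far.
\<close>

lemma finite_orthogonal_join:
  assumes "finite F" "F \<subseteq> carrier S" "pairwise (orthogonal S) F"
  obtains s where "is_lub F s"
    "\<And>c. c \<in> carrier S \<Longrightarrow> is_lub ((\<cdot>) c ` F) (c \<cdot> s)"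
    "\<And>c. c \<in> carrier S \<Longrightarrow> is_lub ((\<lambda>x. x \<cdot> c) ` F) (s \<cdot> c)"
    "\<And>c. c \<in> carrier S \<Longrightarrow> (\<forall>x\<in>F. orthogonal S c x) \<Longrightarrow> orthogonal S c s"
  using assms
proof (induction F arbitrary: thesis rule: finite_induct)
  case empty
  show ?case by (rule empty(1)[of \<zero>]) (use is_lub_zero[of "{}"] in \<open>auto simp: orthogonal_def\<close>)
next
  case (insert a F)
  have [simp]: "a \<in> carrier S" and F: "F \<subseteq> carrier S" using insert.prems by auto
  have aF: "orthogonal S a x" if "x \<in> F" for x
    using insert.prems(3) insert.hyps(2) that by (auto simp: pairwise_insert)
  obtain s where s: "is_lub F s"
    "\<And>c. c \<in> carrier S \<Longrightarrow> is_lub ((\<cdot>) c ` F) (c \<cdot> s)"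
    "\<And>c. c \<in> carrier S \<Longrightarrow> is_lub ((\<lambda>x. x \<cdot> c) ` F) (s \<cdot> c)"
    "\<And>c. c \<in> carrier S \<Longrightarrow> (\<forall>x\<in>F. orthogonal S c x) \<Longrightarrow> orthogonal S c s"
    using insert.IH F insert.prems(3) by (metis pairwise_insert)
  have [simp]: "s \<in> carrier S" using s(1) is_lub_closed by blast
  have as: "orthogonal S a s" using s(4) aF by simp
  then obtain t where t: "is_lub {a, s} t" using orthogonal_join_exists[OF _ _ as] by auto
  \<comment> \<open>A binary join with the join of \<open>B\<close> is a join in two stages of \<open>insert x B\<close>.\<close>
  have stage: "is_lub (insert x B) u" if "is_lub {x, y} u" "is_lub B y" "x \<in> carrier S" "B \<subseteq> carrier S"
    for x y u B
  proof -
    have "is_lub (\<Union>i\<in>{True,False}. if i then {x} else B) u \<longleftrightarrow>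
       is_lub ((\<lambda>i. if i then x else y) ` {True,False}) u"
      by (rule is_lub_UNION) (use that in \<open>auto simp: is_lub_singleton\<close>)
    then show ?thesis using that(1) by (simp add: insert_commute)
  qed
  show ?case
  proof (rule insert.prems(1)[of t])
    show "is_lub (insert a F) t" using stage[OF t s(1)] F by simp
    fix c assume [simp]: "c \<in> carrier S"
    have sub: "(\<cdot>) c ` F \<subseteq> carrier S" "(\<lambda>x. x \<cdot> c) ` F \<subseteq> carrier S" using F by auto
    show "is_lub ((\<cdot>) c ` insert a F) (c \<cdot> t)"
      using stage[OF orthogonal_distrib_left[OF _ _ _ as t] s(2) _ sub(1)] by simp
    show "is_lub ((\<lambda>x. x \<cdot> c) ` insert a F) (t \<cdot> c)"
      using stage[OF orthogonal_distrib_right[OF _ _ _ as t] s(3) _ sub(2)] by simp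
    show "orthogonal S c t" if "\<forall>x\<in>insert a F. orthogonal S c x"
      using orthogonal_join[OF _ _ _ as t, of c] that s(4) by auto
  qed
qed

end

text \<open>
  Orthogonal elements are compatible. The complement of \<open>f\<close> in the Boolean algebra below \<open>e\<close>
  gives \<open>e\<close> only as a join within that order ideal; since \<open>f\<close> and its complement are
  orthogonal, they have a join in \<open>S\<close>, it lies in the ideal, and so the two joins agree.
\<close>

lemma (in boolean_inverse_semigroup) orthogonally_boolean: "orthogonally_boolean_semigroup S"
proof
  fix a b c s
  assume [simp]: "a \<in> carrier S" "b \<in> carrier S" and ab: "orthogonal S a b"
  then have "compatible S a b" by (simp add: compatible_def orthogonal_def)
  then show "\<exists>s. is_lub {a, b} s"
    and "c \<in> carrier S \<Longrightarrow> is_lub {a, b} s \<Longrightarrow> is_lub {c \<cdot> a, c \<cdot> b} (c \<cdot> s)"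
    using compatible_join_exists distrib_left by auto
next
  fix e f assume [simp]: "e \<in> E" "f \<in> E" and fe: "f \<preceq> e"
  let ?L = "(natural_order S)\<lparr>carrier := E\<rparr>"
  let ?L' = "?L\<lparr>carrier := {x \<in> carrier ?L. x \<sqsubseteq>\<^bsub>?L\<^esub> e}\<rparr>"
  have [simp]: "carrier ?L' = {x \<in> E. x \<preceq> e}" "(\<sqsubseteq>\<^bsub>?L'\<^esub>) = (\<preceq>)" by simp_all
  have "unital_boolean_algebra_on ?L'"
    using idempotents_boolean unfolding generalized_boolean_algebra_on_def by auto
  then have "bounded_lattice ?L'"
    and complemented: "\<forall>x \<in> carrier ?L'. \<exists>y \<in> carrier ?L'.
       x \<sqinter>\<^bsub>?L'\<^esub> y = \<bottom>\<^bsub>?L'\<^esub> \<and> x \<squnion>\<^bsub>?L'\<^esub> y = \<top>\<^bsub>?L'\<^esub>"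
    unfolding unital_boolean_algebra_on_def by blast+
  then interpret L: bounded_lattice ?L' by blast
  have fL: "f \<in> carrier ?L'" and eL: "e \<in> carrier ?L'" and zL: "\<zero> \<in> carrier ?L'"
    using fe by simp_all
  obtain g where gL: "g \<in> carrier ?L'" and meet: "f \<sqinter>\<^bsub>?L'\<^esub> g = \<bottom>\<^bsub>?L'\<^esub>"
    and join: "f \<squnion>\<^bsub>?L'\<^esub> g = \<top>\<^bsub>?L'\<^esub>"
    using bspec[OF complemented fL] by blast
  have [simp]: "g \<in> E" and ge: "g \<preceq> e" using gL by simp_all
  have fg: "f \<cdot> g \<preceq> f" "f \<cdot> g \<preceq> g"
    by (rule leqI_right[of _ g] leqI_left[of _ f]; simp)+
  then have fgL: "f \<cdot> g \<in> carrier ?L'"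
    using leq_trans[OF fg(2) ge] by simp
  have "f \<cdot> g \<sqsubseteq>\<^bsub>?L'\<^esub> \<bottom>\<^bsub>?L'\<^esub>"
    unfolding meet[symmetric] using fg by (intro L.meet_le fL gL fgL) simp_all
  moreover have "\<bottom>\<^bsub>?L'\<^esub> \<sqsubseteq>\<^bsub>?L'\<^esub> \<zero>" by (rule L.bottom_lower[OF zL])
  ultimately have "f \<cdot> g \<sqsubseteq>\<^bsub>?L'\<^esub> \<zero>"
    by (rule L.le_trans[OF _ _ fgL L.bottom_closed zL])
  then have fg0: "f \<cdot> g = \<zero>" by simp
  then have "orthogonal S f g" by (simp add: orthogonal_idem_iff)
  then have "compatible S f g" by (simp add: compatible_def orthogonal_def)
  then obtain s where s: "is_lub {f, g} s" using compatible_join_exists[of f g] by auto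
  then have [simp]: "s \<in> carrier S" and fs: "f \<preceq> s" and gs: "g \<preceq> s" and se: "s \<preceq> e"
    using fe ge by (auto simp: is_lub_iff)
  have sL: "s \<in> carrier ?L'" using leq_idem_imp_idem[OF se] se by simp
  have "e \<sqsubseteq>\<^bsub>?L'\<^esub> \<top>\<^bsub>?L'\<^esub>" by (rule L.top_higher[OF eL])
  moreover have "\<top>\<^bsub>?L'\<^esub> \<sqsubseteq>\<^bsub>?L'\<^esub> s"
    unfolding join[symmetric] using fs gs by (intro L.join_le fL gL sL) simp_all
  ultimately have "e \<sqsubseteq>\<^bsub>?L'\<^esub> s" by (rule L.le_trans[OF _ _ eL L.top_closed sL])
  then have "s = e" using se by (intro leq_antisym) simp_all
  then show "\<exists>g\<in>E. f \<cdot> g = \<zero> \<and> is_lub {f, g} e" using fg0 s \<open>g \<in> E\<close> by blast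
qed

section \<open>The inverse semigroup of rook matrices\<close>

context inverse_semigroup_with_zero
begin

lemma is_lub_range_single:
  assumes "is_lub (range f) s" "\<And>k. k \<noteq> m \<Longrightarrow> f k = \<zero>" "f m \<in> carrier S"
  shows "s = f m"
proof -
  have sub: "range f \<subseteq> carrier S" using assms(2,3) by (metis image_subset_iff zero_closed)
  have "is_lub (range f) (f m)"
    unfolding is_lub_iff[OF sub] using assms(2,3) by (metis leq_refl rangeE rangeI zero_leq)
  then show ?thesis using assms(1) is_lub_unique by blast
qed

lemma is_lub_range_zero: "\<lbrakk>is_lub (range f) s; \<And>k. f k = \<zero>\<rbrakk> \<Longrightarrow> s = \<zero>"
  using is_lub_zero[of "range f" s] by blast

end

context orthogonally_boolean_semigroup
begin

abbreviation M :: "(nat \<Rightarrow> nat \<Rightarrow> 'a) semigroup_with_zero" where "M \<equiv> rook_matrices S"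

text \<open>
  The inverse of a rook matrix is its transpose with inverted entries, once this is known to be
  the unique inverse.
\<close>

definition adjoint :: "(nat \<Rightarrow> nat \<Rightarrow> 'a) \<Rightarrow> nat \<Rightarrow> nat \<Rightarrow> 'a"
  where "adjoint A = (\<lambda>i j. (A j i)\<^sup>\<star>)"

lemma adjoint_entry [simp]: "adjoint A i j = (A j i)\<^sup>\<star>"
  by (simp add: adjoint_def)

lemma M_zero: "sg_zero M = (\<lambda>i j. \<zero>)"
  by (simp add: rook_matrices_def)

lemma M_carrierI:
  assumes "\<And>i j. A i j \<in> carrier S" "finite {(i, j). A i j \<noteq> \<zero>}"
    "\<And>i j k. j \<noteq> k \<Longrightarrow> (A i j)\<^sup>\<star> \<cdot> A i k = \<zero>"
    "\<And>i j k. i \<noteq> k \<Longrightarrow> A i j \<cdot> (A k j)\<^sup>\<star> = \<zero>"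
  shows "A \<in> carrier M"
  using assms by (simp add: rook_matrices_def)

lemma
  assumes "A \<in> carrier M"
  shows entry_closed: "A i j \<in> carrier S"
    and finite_support: "finite {(i, j). A i j \<noteq> \<zero>}"
    and row_disjoint: "j \<noteq> k \<Longrightarrow> (A i j)\<^sup>\<star> \<cdot> A i k = \<zero>"
    and column_disjoint: "i \<noteq> k \<Longrightarrow> A i j \<cdot> (A k j)\<^sup>\<star> = \<zero>"
  using assms by (auto simp: rook_matrices_def)

lemma adjoint_closed [simp]:
  assumes A: "A \<in> carrier M"
  shows "adjoint A \<in> carrier M"
proof (rule M_carrierI)
  note [simp] = entry_closed[OF A]
  have "{(i, j). adjoint A i j \<noteq> \<zero>} \<subseteq> prod.swap ` {(i, j). A i j \<noteq> \<zero>}"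
    using A by force
  then show "finite {(i, j). adjoint A i j \<noteq> \<zero>}"
    using finite_support[OF A] finite_surj by blast
qed (use A in \<open>auto simp: entry_closed row_disjoint column_disjoint\<close>)

lemma adjoint_adjoint [simp]: "A \<in> carrier M \<Longrightarrow> adjoint (adjoint A) = A"
  by (simp add: adjoint_def entry_closed)

lemma disjoint_starI:
  "\<lbrakk>a\<^sup>\<star> \<cdot> b = \<zero>; a \<in> carrier S; b \<in> carrier S\<rbrakk> \<Longrightarrow> b\<^sup>\<star> \<cdot> a = \<zero>"
  by (metis star_closed star_eq_zero_iff star_mult star_star sg_closed)

text \<open>
  The terms of an entry of a product are orthogonal, because the row conditions on \<open>A\<close> and the
  column conditions on \<open>B\<close> annihilate the two products. So the supremum that defines the
  entry exists and multiplication distributes over it.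
\<close>

lemma entry_products_orthogonal:
  assumes A: "A \<in> carrier M" and B: "B \<in> carrier M"
  shows "finite (range (\<lambda>k. A i k \<cdot> B k j))" "range (\<lambda>k. A i k \<cdot> B k j) \<subseteq> carrier S"
    "pairwise (orthogonal S) (range (\<lambda>k. A i k \<cdot> B k j))"
proof -
  have [simp]: "A i j \<in> carrier S" "B i j \<in> carrier S" for i j
    using entry_closed[OF A] entry_closed[OF B] by simp_all
  have fin: "finite {k. A i k \<noteq> \<zero>}"
    using finite_vimageI[OF finite_support[OF A], of "Pair i"] by (simp add: inj_on_def vimage_def)
  have "A i k \<cdot> B k j \<in> insert \<zero> ((\<lambda>k. A i k \<cdot> B k j) ` {k. A i k \<noteq> \<zero>})" for k
    by (cases "A i k = \<zero>") simp_all
  then have "range (\<lambda>k. A i k \<cdot> B k j) \<subseteq> insert \<zero> ((\<lambda>k. A i k \<cdot> B k j) ` {k. A i k \<noteq> \<zero>})"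
    by blast
  then show "finite (range (\<lambda>k. A i k \<cdot> B k j))"
    by (rule finite_subset) (simp add: fin)
  show "range (\<lambda>k. A i k \<cdot> B k j) \<subseteq> carrier S" by auto
  have *: "orthogonal S (A i k \<cdot> B k j) (A i m \<cdot> B m j)" if "k \<noteq> m" for k m
  proof -
    have "(B k j)\<^sup>\<star> \<cdot> (A i k)\<^sup>\<star> \<cdot> (A i m \<cdot> B m j) = (B k j)\<^sup>\<star> \<cdot> ((A i k)\<^sup>\<star> \<cdot> A i m \<cdot> B m j)"
      by simp
    also have "\<dots> = \<zero>" by (simp del: sg_assoc add: row_disjoint[OF A that])
    finally have 1: "(B k j)\<^sup>\<star> \<cdot> (A i k)\<^sup>\<star> \<cdot> (A i m \<cdot> B m j) = \<zero>" .
    have "A i k \<cdot> B k j \<cdot> ((B m j)\<^sup>\<star> \<cdot> (A i m)\<^sup>\<star>) = A i k \<cdot> (B k j \<cdot> (B m j)\<^sup>\<star> \<cdot> (A i m)\<^sup>\<star>)"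
      by simp
    also have "\<dots> = \<zero>" by (simp del: sg_assoc add: column_disjoint[OF B that])
    finally show ?thesis using 1 by (simp add: orthogonal_def)
  qed
  show "pairwise (orthogonal S) (range (\<lambda>k. A i k \<cdot> B k j))"
  proof (rule pairwiseI)
    fix x y assume "x \<in> range (\<lambda>k. A i k \<cdot> B k j)" "y \<in> range (\<lambda>k. A i k \<cdot> B k j)" "x \<noteq> y"
    then obtain k m where "x = A i k \<cdot> B k j" "y = A i m \<cdot> B m j" "k \<noteq> m" by auto
    then show "orthogonal S x y" using * by simp
  qed
qed

lemma M_mult_entry:
  assumes A: "A \<in> carrier M" and B: "B \<in> carrier M"
  shows "is_lub (range (\<lambda>k. A i k \<cdot> B k j)) ((A \<cdot>\<^bsub>M\<^esub> B) i j)"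
    and "c \<in> carrier S \<Longrightarrow> is_lub (range (\<lambda>k. c \<cdot> (A i k \<cdot> B k j))) (c \<cdot> (A \<cdot>\<^bsub>M\<^esub> B) i j)"
    and "c \<in> carrier S \<Longrightarrow> is_lub (range (\<lambda>k. A i k \<cdot> B k j \<cdot> c)) ((A \<cdot>\<^bsub>M\<^esub> B) i j \<cdot> c)"
proof -
  obtain s where s: "is_lub (range (\<lambda>k. A i k \<cdot> B k j)) s"
    "\<And>c. c \<in> carrier S \<Longrightarrow> is_lub ((\<cdot>) c ` range (\<lambda>k. A i k \<cdot> B k j)) (c \<cdot> s)"
    "\<And>c. c \<in> carrier S \<Longrightarrow> is_lub ((\<lambda>x. x \<cdot> c) ` range (\<lambda>k. A i k \<cdot> B k j)) (s \<cdot> c)"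
    by (rule finite_orthogonal_join[OF entry_products_orthogonal[OF A B, of i j]]) blast
  have "(A \<cdot>\<^bsub>M\<^esub> B) i j = s"
    using Sup_eqI[OF s(1)] by (simp add: rook_matrices_def)
  with s show "is_lub (range (\<lambda>k. A i k \<cdot> B k j)) ((A \<cdot>\<^bsub>M\<^esub> B) i j)"
    and "c \<in> carrier S \<Longrightarrow> is_lub (range (\<lambda>k. c \<cdot> (A i k \<cdot> B k j))) (c \<cdot> (A \<cdot>\<^bsub>M\<^esub> B) i j)"
    and "c \<in> carrier S \<Longrightarrow> is_lub (range (\<lambda>k. A i k \<cdot> B k j \<cdot> c)) ((A \<cdot>\<^bsub>M\<^esub> B) i j \<cdot> c)"
    by (simp_all add: image_image)
qed

lemma M_mult_entry_single:
  assumes "A \<in> carrier M" "B \<in> carrier M" "\<And>k. k \<noteq> m \<Longrightarrow> A i k \<cdot> B k j = \<zero>"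
  shows "(A \<cdot>\<^bsub>M\<^esub> B) i j = A i m \<cdot> B m j"
  using is_lub_range_single[OF M_mult_entry(1)[OF assms(1,2)], of m i j] assms entry_closed by simp

lemma M_mult_entry_zero:
  assumes "A \<in> carrier M" "B \<in> carrier M" "\<And>k. A i k \<cdot> B k j = \<zero>"
  shows "(A \<cdot>\<^bsub>M\<^esub> B) i j = \<zero>"
  using is_lub_range_zero[OF M_mult_entry(1)[OF assms(1,2)], of i j] assms(3) by simp

lemma adjoint_mult:
  assumes A: "A \<in> carrier M" and B: "B \<in> carrier M"
  shows "adjoint (A \<cdot>\<^bsub>M\<^esub> B) = adjoint B \<cdot>\<^bsub>M\<^esub> adjoint A"
proof (intro ext)
  fix i j
  have [simp]: "A i j \<in> carrier S" "B i j \<in> carrier S" for i j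
    using entry_closed[OF A] entry_closed[OF B] by simp_all
  have "is_lub (range (\<lambda>k. (B k i)\<^sup>\<star> \<cdot> (A j k)\<^sup>\<star>)) (((A \<cdot>\<^bsub>M\<^esub> B) j i)\<^sup>\<star>)"
    using is_lub_star[OF M_mult_entry(1)[OF A B, of j i] entry_products_orthogonal(2)[OF A B]]
    by (simp add: image_image)
  moreover have "is_lub (range (\<lambda>k. (B k i)\<^sup>\<star> \<cdot> (A j k)\<^sup>\<star>)) ((adjoint B \<cdot>\<^bsub>M\<^esub> adjoint A) i j)"
    using M_mult_entry(1)[of "adjoint B" "adjoint A" i j] A B by simp
  ultimately show "adjoint (A \<cdot>\<^bsub>M\<^esub> B) i j = (adjoint B \<cdot>\<^bsub>M\<^esub> adjoint A) i j"
    unfolding adjoint_entry using is_lub_unique by blast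
qed

lemma M_mult_entry_closed:
  "\<lbrakk>A \<in> carrier M; B \<in> carrier M\<rbrakk> \<Longrightarrow> (A \<cdot>\<^bsub>M\<^esub> B) i j \<in> carrier S"
  using M_mult_entry(1) is_lub_closed by blast

text \<open>
  Distributivity reduces this to the products of single terms. Distinct inner indices are
  separated by the rows of \<open>A\<close>; for equal inner indices, an idempotent is left between two
  entries of one row of \<open>B\<close>.
\<close>

lemma M_mult_row_disjoint:
  assumes A: "A \<in> carrier M" and B: "B \<in> carrier M" and "j \<noteq> l"
  shows "((A \<cdot>\<^bsub>M\<^esub> B) i j)\<^sup>\<star> \<cdot> (A \<cdot>\<^bsub>M\<^esub> B) i l = \<zero>"
proof -
  have [simp]: "A i j \<in> carrier S" "B i j \<in> carrier S" "(A \<cdot>\<^bsub>M\<^esub> B) i j \<in> carrier S" for i j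
    using entry_closed[OF A] entry_closed[OF B] M_mult_entry_closed[OF A B] by simp_all
  have *: "(A i k \<cdot> B k l)\<^sup>\<star> \<cdot> (A i m \<cdot> B m j) = \<zero>" for k m
  proof (cases "k = m")
    case True
    have "(B k l)\<^sup>\<star> \<cdot> ((A i k)\<^sup>\<star> \<cdot> A i k \<cdot> B k j) = \<zero>"
      by (rule disjoint_conj) (use \<open>j \<noteq> l\<close> row_disjoint[OF B] in simp_all)
    then show ?thesis using True by simp
  next
    case False
    have "(A i k \<cdot> B k l)\<^sup>\<star> \<cdot> (A i m \<cdot> B m j) = (B k l)\<^sup>\<star> \<cdot> ((A i k)\<^sup>\<star> \<cdot> A i m \<cdot> B m j)"
      by simp
    also have "\<dots> = \<zero>" by (simp del: sg_assoc add: row_disjoint[OF A False])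
    finally show ?thesis .
  qed
  have "(A i k \<cdot> B k l)\<^sup>\<star> \<cdot> (A \<cdot>\<^bsub>M\<^esub> B) i j = \<zero>" for k
    by (rule is_lub_range_zero[OF M_mult_entry(2)[OF A B]]) (use * in simp_all)
  then have "((A \<cdot>\<^bsub>M\<^esub> B) i j)\<^sup>\<star> \<cdot> (A i k \<cdot> B k l) = \<zero>" for k
    by (rule disjoint_starI) simp_all
  then show ?thesis
    by (intro is_lub_range_zero[OF M_mult_entry(2)[OF A B]]) simp_all
qed

lemma M_mult_closed:
  assumes A: "A \<in> carrier M" and B: "B \<in> carrier M"
  shows "A \<cdot>\<^bsub>M\<^esub> B \<in> carrier M"
proof (rule M_carrierI)
  note [simp] = M_mult_entry_closed[OF A B]
  show "(A \<cdot>\<^bsub>M\<^esub> B) i j \<in> carrier S" for i j by simp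
  have "{(i, j). (A \<cdot>\<^bsub>M\<^esub> B) i j \<noteq> \<zero>} \<subseteq>
    fst ` {(i, j). A i j \<noteq> \<zero>} \<times> snd ` {(i, j). B i j \<noteq> \<zero>}"
  proof
    fix p assume "p \<in> {(i, j). (A \<cdot>\<^bsub>M\<^esub> B) i j \<noteq> \<zero>}"
    then obtain i j where p: "p = (i, j)" and "(A \<cdot>\<^bsub>M\<^esub> B) i j \<noteq> \<zero>" by blast
    then obtain k where "A i k \<cdot> B k j \<noteq> \<zero>"
      using M_mult_entry_zero[OF A B] by blast
    then have "A i k \<noteq> \<zero>" "B k j \<noteq> \<zero>" using entry_closed[OF A] entry_closed[OF B] by auto
    then show "p \<in> fst ` {(i, j). A i j \<noteq> \<zero>} \<times> snd ` {(i, j). B i j \<noteq> \<zero>}"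
      unfolding p by force
  qed
  then show "finite {(i, j). (A \<cdot>\<^bsub>M\<^esub> B) i j \<noteq> \<zero>}"
    using finite_support[OF A] finite_support[OF B] finite_subset by blast
  show "((A \<cdot>\<^bsub>M\<^esub> B) i j)\<^sup>\<star> \<cdot> (A \<cdot>\<^bsub>M\<^esub> B) i k = \<zero>" if "j \<noteq> k" for i j k
    by (rule M_mult_row_disjoint[OF A B that])
  \<comment> \<open>The column condition is the row condition for the adjoint of the product.\<close>
  show "(A \<cdot>\<^bsub>M\<^esub> B) i j \<cdot> ((A \<cdot>\<^bsub>M\<^esub> B) k j)\<^sup>\<star> = \<zero>" if "i \<noteq> k" for i j k
    using M_mult_row_disjoint[of "adjoint B" "adjoint A" i k j] A B that
    by (simp flip: adjoint_mult)
qed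

text \<open>
  Both sides are the join of the same set of threefold products, taken in two different stages.
\<close>

lemma M_assoc:
  assumes A: "A \<in> carrier M" and B: "B \<in> carrier M" and C: "C \<in> carrier M"
  shows "A \<cdot>\<^bsub>M\<^esub> B \<cdot>\<^bsub>M\<^esub> C = A \<cdot>\<^bsub>M\<^esub> (B \<cdot>\<^bsub>M\<^esub> C)"
proof (intro ext)
  fix i l
  have [simp]: "A i j \<in> carrier S" "B i j \<in> carrier S" "C i j \<in> carrier S" for i j
    using entry_closed[OF A] entry_closed[OF B] entry_closed[OF C] by simp_all
  note AB = M_mult_closed[OF A B] and BC = M_mult_closed[OF B C]
  have 1: "is_lub (\<Union>j. range (\<lambda>k. A i k \<cdot> (B k j \<cdot> C j l))) ((A \<cdot>\<^bsub>M\<^esub> B \<cdot>\<^bsub>M\<^esub> C) i l)"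
    by (subst is_lub_UNION[OF _ _])
      (use M_mult_entry(3)[OF A B, of "C _ l" i] M_mult_entry(1)[OF AB C, of i l] in auto)
  have 2: "is_lub (\<Union>k. range (\<lambda>j. A i k \<cdot> (B k j \<cdot> C j l))) ((A \<cdot>\<^bsub>M\<^esub> (B \<cdot>\<^bsub>M\<^esub> C)) i l)"
    by (subst is_lub_UNION[OF _ _])
      (use M_mult_entry(2)[OF B C, of "A i _" _ l] M_mult_entry(1)[OF A BC, of i l] in auto)
  have "(\<Union>j. range (\<lambda>k. A i k \<cdot> (B k j \<cdot> C j l))) = (\<Union>k. range (\<lambda>j. A i k \<cdot> (B k j \<cdot> C j l)))"
    by blast
  from 1[unfolded this] 2 show "(A \<cdot>\<^bsub>M\<^esub> B \<cdot>\<^bsub>M\<^esub> C) i l = (A \<cdot>\<^bsub>M\<^esub> (B \<cdot>\<^bsub>M\<^esub> C)) i l"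
    by (rule is_lub_unique)
qed

lemma M_projection_off_diagonal:
  assumes A: "A \<in> carrier M" and "i \<noteq> j"
  shows "(A \<cdot>\<^bsub>M\<^esub> adjoint A) i j = \<zero>"
  by (rule M_mult_entry_zero) (use A entry_closed[OF A] column_disjoint[OF A] \<open>i \<noteq> j\<close> in simp_all)

lemma M_regular:
  assumes A: "A \<in> carrier M"
  shows "A \<cdot>\<^bsub>M\<^esub> adjoint A \<cdot>\<^bsub>M\<^esub> A = A"
proof (intro ext)
  fix i j
  let ?P = "A \<cdot>\<^bsub>M\<^esub> adjoint A"
  have [simp]: "A i j \<in> carrier S" for i j by (rule entry_closed[OF A])
  have "(?P \<cdot>\<^bsub>M\<^esub> A) i j = ?P i i \<cdot> A i j"
    by (rule M_mult_entry_single)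
      (use A M_mult_closed[OF A, of "adjoint A"] M_projection_off_diagonal[OF A] in \<open>simp_all\<close>)
  also have "\<dots> = A i j \<cdot> adjoint A j i \<cdot> A i j"
    by (rule is_lub_range_single[OF M_mult_entry(3)])
      (use A row_disjoint[OF A] in simp_all)
  also have "\<dots> = A i j" by simp
  finally show "(?P \<cdot>\<^bsub>M\<^esub> A) i j = A i j" .
qed

lemma M_mult_diagonal:
  assumes P: "P \<in> carrier M" and Q: "Q \<in> carrier M"
    and diag: "\<And>i j. i \<noteq> j \<Longrightarrow> P i j = \<zero>"
  shows "(P \<cdot>\<^bsub>M\<^esub> Q) i j = P i i \<cdot> Q i j"
  by (rule M_mult_entry_single) (use assms entry_closed[OF Q] in auto)

text \<open>
  Projections are diagonal by the column condition, with idempotent entries, so they commute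
  because idempotents of \<open>S\<close> do.
\<close>

lemma M_projections_commute:
  assumes A: "A \<in> carrier M" and B: "B \<in> carrier M"
  shows "A \<cdot>\<^bsub>M\<^esub> adjoint A \<cdot>\<^bsub>M\<^esub> (B \<cdot>\<^bsub>M\<^esub> adjoint B) = B \<cdot>\<^bsub>M\<^esub> adjoint B \<cdot>\<^bsub>M\<^esub> (A \<cdot>\<^bsub>M\<^esub> adjoint A)"
proof (intro ext)
  fix i j
  have P: "C \<cdot>\<^bsub>M\<^esub> adjoint C \<in> carrier M" if "C \<in> carrier M" for C
    using that M_mult_closed by simp
  have E: "(C \<cdot>\<^bsub>M\<^esub> adjoint C) i i \<in> E" if "C \<in> carrier M" for C
  proof (rule idemI)
    let ?P = "C \<cdot>\<^bsub>M\<^esub> adjoint C"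
    have "?P \<cdot>\<^bsub>M\<^esub> ?P = C \<cdot>\<^bsub>M\<^esub> adjoint C \<cdot>\<^bsub>M\<^esub> C \<cdot>\<^bsub>M\<^esub> adjoint C"
      using M_assoc[OF P[OF that] that, of "adjoint C"] that by simp
    also have "\<dots> = ?P" using M_regular that by simp
    finally show "?P i i \<cdot> ?P i i = ?P i i"
      using M_mult_diagonal[OF P[OF that] P[OF that] M_projection_off_diagonal[OF that], of i i]
      by simp
  qed (rule entry_closed[OF P[OF that]])
  show "(A \<cdot>\<^bsub>M\<^esub> adjoint A \<cdot>\<^bsub>M\<^esub> (B \<cdot>\<^bsub>M\<^esub> adjoint B)) i j = (B \<cdot>\<^bsub>M\<^esub> adjoint B \<cdot>\<^bsub>M\<^esub> (A \<cdot>\<^bsub>M\<^esub> adjoint A)) i j"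
    using idem_commute[OF E[OF A] E[OF B]] entry_closed[OF P[OF A]] entry_closed[OF P[OF B]]
      M_projection_off_diagonal[OF A, of i j] M_projection_off_diagonal[OF B, of i j]
    by (cases "i = j")
      (simp_all add: M_mult_diagonal[OF P[OF A] P[OF B] M_projection_off_diagonal[OF A]]
         M_mult_diagonal[OF P[OF B] P[OF A] M_projection_off_diagonal[OF B]])
qed

lemma
  shows M_inverse_semigroup: "inverse_semigroup M"
    and M_star: "A \<in> carrier M \<Longrightarrow> sg_inv M A = adjoint A"
    and M_idem_projection: "\<lbrakk>A \<in> carrier M; A \<cdot>\<^bsub>M\<^esub> A = A\<rbrakk> \<Longrightarrow> A \<cdot>\<^bsub>M\<^esub> adjoint A = A"
  using inverse_semigroup_from_involution[of M adjoint, OF M_mult_closed M_assoc adjoint_closed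
      adjoint_adjoint adjoint_mult M_regular M_projections_commute]
  by blast+

lemma M_inverse_semigroup_with_zero: "inverse_semigroup_with_zero M"
proof -
  interpret M: inverse_semigroup M by (rule M_inverse_semigroup)
  have zero: "sg_zero M \<in> carrier M" by (rule M_carrierI) (simp_all add: M_zero)
  have "sg_zero M \<cdot>\<^bsub>M\<^esub> A = sg_zero M" "A \<cdot>\<^bsub>M\<^esub> sg_zero M = sg_zero M" if "A \<in> carrier M" for A
    by (intro ext; use that zero entry_closed[OF that] M_mult_entry_zero in \<open>simp add: M_zero\<close>)+
  then show ?thesis using zero by unfold_locales auto
qed

section \<open>Orthogonal joins of rook matrices\<close>

text \<open>
  A relation rather than an operation, because the join of two entries need not exist unless
  they are compatible.
\<close>

definition entrywise_join :: "(nat \<Rightarrow> nat \<Rightarrow> 'a) \<Rightarrow> (nat \<Rightarrow> nat \<Rightarrow> 'a) \<Rightarrow> (nat \<Rightarrow> nat \<Rightarrow> 'a) \<Rightarrow> bool"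
  where "entrywise_join A B C \<longleftrightarrow> (\<forall>i j. is_lub {A i j, B i j} (C i j))"

lemma entrywise_joinD: "entrywise_join A B C \<Longrightarrow> is_lub {A i j, B i j} (C i j)"
  by (simp add: entrywise_join_def)

lemma entrywise_join_unique:
  "\<lbrakk>entrywise_join A B C; entrywise_join A B C'\<rbrakk> \<Longrightarrow> C = C'"
  unfolding entrywise_join_def by (intro ext) (blast intro: is_lub_unique)

lemma entrywise_join_zero_right: "A \<in> carrier M \<Longrightarrow> entrywise_join A (sg_zero M) A"
  using entry_closed[of A] by (simp add: entrywise_join_def M_zero is_lub_pair_zero)

lemma entrywise_join_zero_left: "A \<in> carrier M \<Longrightarrow> entrywise_join (sg_zero M) A A"
  using entrywise_join_zero_right by (simp add: entrywise_join_def insert_commute)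

lemma entrywise_join_adjoint:
  assumes "A \<in> carrier M" "B \<in> carrier M" "entrywise_join A B C"
  shows "entrywise_join (adjoint A) (adjoint B) (adjoint C)"
  unfolding entrywise_join_def
  using is_lub_star[OF entrywise_joinD[OF assms(3)]] entry_closed[OF assms(1)] entry_closed[OF assms(2)]
  by simp

lemma M_orthogonal_iff:
  assumes A: "A \<in> carrier M" and B: "B \<in> carrier M"
  shows "orthogonal M A B \<longleftrightarrow>
    adjoint A \<cdot>\<^bsub>M\<^esub> B = sg_zero M \<and> A \<cdot>\<^bsub>M\<^esub> adjoint B = sg_zero M"
  using assms by (simp add: orthogonal_def M_star)

lemma M_mult_eq_zeroD:
  assumes A: "A \<in> carrier M" and B: "B \<in> carrier M" and "A \<cdot>\<^bsub>M\<^esub> B = sg_zero M"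
  shows "A i k \<cdot> B k j = \<zero>"
proof -
  have "is_lub (range (\<lambda>k. A i k \<cdot> B k j)) \<zero>"
    using M_mult_entry(1)[OF A B, of i j] assms(3) by (simp add: M_zero)
  then have "A i k \<cdot> B k j \<preceq> \<zero>"
    unfolding is_lub_iff[OF entry_products_orthogonal(2)[OF A B]] by blast
  then show ?thesis using entry_closed[OF A] entry_closed[OF B] by simp
qed

lemma orthogonal_entries:
  assumes A: "A \<in> carrier M" and B: "B \<in> carrier M" and AB: "orthogonal M A B"
  shows "(A k i)\<^sup>\<star> \<cdot> B k j = \<zero>" "A i k \<cdot> (B j k)\<^sup>\<star> = \<zero>" "orthogonal S (A i j) (B i j)"
proof -
  show *: "(A k i)\<^sup>\<star> \<cdot> B k j = \<zero>" "A i k \<cdot> (B j k)\<^sup>\<star> = \<zero>" for i j k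
    using M_mult_eq_zeroD[of "adjoint A" B i k j] M_mult_eq_zeroD[of A "adjoint B" i k j]
      AB A B by (simp_all add: M_orthogonal_iff)
  show "orthogonal S (A i j) (B i j)" by (simp add: orthogonal_def *)
qed

lemma M_orthogonal_adjoint:
  "\<lbrakk>A \<in> carrier M; B \<in> carrier M; orthogonal M A B\<rbrakk> \<Longrightarrow> orthogonal M (adjoint A) (adjoint B)"
  by (simp add: M_orthogonal_iff)

text \<open>
  Multiplication distributes over the join in either factor, so this follows from disjointness
  of each of the four pairs of entries of \<open>A\<close> and \<open>B\<close>.
\<close>

lemma entrywise_join_row_disjoint:
  assumes A: "A \<in> carrier M" and B: "B \<in> carrier M"
    and AB: "orthogonal M A B" and C: "entrywise_join A B C" and jk: "j \<noteq> k"
  shows "(C i j)\<^sup>\<star> \<cdot> C i k = \<zero>"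
proof -
  have [simp]: "A i j \<in> carrier S" "B i j \<in> carrier S" "C i j \<in> carrier S" for i j
    using entry_closed[OF A] entry_closed[OF B] is_lub_closed[OF entrywise_joinD[OF C]] by simp_all
  have dist: "c \<cdot> C i j = \<zero>" if "c \<cdot> A i j = \<zero>" "c \<cdot> B i j = \<zero>" "c \<in> carrier S" for c i j
    using orthogonal_distrib_left[OF _ _ _ orthogonal_entries(3)[OF A B AB] entrywise_joinD[OF C], of i j c]
     that by (simp add: is_lub_zero)
  have "(C i k)\<^sup>\<star> \<cdot> A i j = \<zero>"
  proof (rule disjoint_starI)
    show "(A i j)\<^sup>\<star> \<cdot> C i k = \<zero>"
      by (rule dist) (simp_all add: row_disjoint[OF A jk] orthogonal_entries[OF A B AB])
  qed simp_all
  moreover have "(C i k)\<^sup>\<star> \<cdot> B i j = \<zero>"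
  proof (rule disjoint_starI)
    have "(B i j)\<^sup>\<star> \<cdot> A i k = \<zero>"
      by (rule disjoint_starI) (simp_all add: orthogonal_entries[OF A B AB])
    then show "(B i j)\<^sup>\<star> \<cdot> C i k = \<zero>"
      by (rule dist) (simp_all add: row_disjoint[OF B jk])
  qed simp_all
  ultimately have "(C i k)\<^sup>\<star> \<cdot> C i j = \<zero>" by (intro dist) simp_all
  then show ?thesis by (rule disjoint_starI) simp_all
qed

lemma entrywise_join_closed:
  assumes A: "A \<in> carrier M" and B: "B \<in> carrier M"
    and AB: "orthogonal M A B" and C: "entrywise_join A B C"
  shows "C \<in> carrier M"
proof (rule M_carrierI)
  show [simp]: "C i j \<in> carrier S" for i j by (rule is_lub_closed[OF entrywise_joinD[OF C]])
  have "C i j = \<zero>" if "A i j = \<zero>" "B i j = \<zero>" for i j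
    using entrywise_joinD[OF C, of i j] that by (simp add: is_lub_zero)
  then have "{(i, j). C i j \<noteq> \<zero>} \<subseteq> {(i, j). A i j \<noteq> \<zero>} \<union> {(i, j). B i j \<noteq> \<zero>}"
    by blast
  then show "finite {(i, j). C i j \<noteq> \<zero>}"
    using finite_support[OF A] finite_support[OF B] finite_subset by blast
  show "(C i j)\<^sup>\<star> \<cdot> C i k = \<zero>" if "j \<noteq> k" for i j k
    by (rule entrywise_join_row_disjoint[OF A B AB C that])
  show "C i j \<cdot> (C k j)\<^sup>\<star> = \<zero>" if "i \<noteq> k" for i j k
    using entrywise_join_row_disjoint[OF _ _ M_orthogonal_adjoint[OF A B AB]
        entrywise_join_adjoint[OF A B C] that, of j] A B by simp
qed

text \<open>
  Each entry of \<open>X \<cdot> C\<close> is a join over the inner index and over the two matrices, and the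
  order in which these joins are taken does not matter.
\<close>

lemma entrywise_join_mult_left:
  assumes A: "A \<in> carrier M" and B: "B \<in> carrier M" and X: "X \<in> carrier M"
    and AB: "orthogonal M A B" and C: "entrywise_join A B C"
  shows "entrywise_join (X \<cdot>\<^bsub>M\<^esub> A) (X \<cdot>\<^bsub>M\<^esub> B) (X \<cdot>\<^bsub>M\<^esub> C)"
  unfolding entrywise_join_def
proof (intro allI)
  fix i j
  have CM: "C \<in> carrier M" by (rule entrywise_join_closed[OF A B AB C])
  have [simp]: "A i j \<in> carrier S" "B i j \<in> carrier S" "X i j \<in> carrier S" for i j
    using entry_closed[OF A] entry_closed[OF B] entry_closed[OF X] by simp_all
  let ?f = "\<lambda>(Y :: nat \<Rightarrow> nat \<Rightarrow> 'a) k. X i k \<cdot> Y k j"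
  have "is_lub {?f A k, ?f B k} (?f C k)" for k
    by (rule orthogonal_distrib_left[OF _ _ _ orthogonal_entries(3)[OF A B AB] entrywise_joinD[OF C]])
      simp_all
  then have "is_lub (\<Union>k. {?f A k, ?f B k}) ((X \<cdot>\<^bsub>M\<^esub> C) i j)"
    by (subst is_lub_UNION[where s = "?f C"]) (simp_all add: M_mult_entry(1)[OF X CM])
  also have "(\<Union>k. {?f A k, ?f B k}) = (\<Union>Y\<in>{A, B}. range (?f Y))" by auto
  finally have "is_lub (\<Union>Y\<in>{A, B}. range (?f Y)) ((X \<cdot>\<^bsub>M\<^esub> C) i j)" .
  moreover have "is_lub (range (?f Y)) ((X \<cdot>\<^bsub>M\<^esub> Y) i j)" "range (?f Y) \<subseteq> carrier S" if "Y \<in> {A, B}" for Y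
    using that M_mult_entry(1)[OF X A, of i j] M_mult_entry(1)[OF X B, of i j] by auto
  ultimately have "is_lub ((\<lambda>Y. (X \<cdot>\<^bsub>M\<^esub> Y) i j) ` {A, B}) ((X \<cdot>\<^bsub>M\<^esub> C) i j)"
    using is_lub_UNION[where I = "{A, B}" and A = "\<lambda>Y. range (?f Y)" and s = "\<lambda>Y. (X \<cdot>\<^bsub>M\<^esub> Y) i j"] by blast
  then show "is_lub {(X \<cdot>\<^bsub>M\<^esub> A) i j, (X \<cdot>\<^bsub>M\<^esub> B) i j} ((X \<cdot>\<^bsub>M\<^esub> C) i j)" by simp
qed

text \<open>
  The order of \<open>M\<close> is defined by multiplication and not entrywise, so the supremum has to be
  computed through products: the domain \<open>adjoint C \<cdot> C\<close> is the entrywise join of the domains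
  of \<open>A\<close> and \<open>B\<close>, and restricting an upper bound \<open>D\<close> to it gives the entrywise join of
  \<open>A\<close> and \<open>B\<close>, which is \<open>C\<close>.
\<close>

lemma entrywise_join_is_lub:
  assumes A: "A \<in> carrier M" and B: "B \<in> carrier M"
    and AB: "orthogonal M A B" and C: "entrywise_join A B C"
  shows "inverse_semigroup.is_lub M {A, B} C"
proof -
  interpret M: inverse_semigroup_with_zero M by (rule M_inverse_semigroup_with_zero)
  have CM [simp]: "C \<in> carrier M" by (rule entrywise_join_closed[OF A B AB C])
  note [simp] = A B M_star
  note [simp del] = M.sg_assoc
  have AB0: "adjoint A \<cdot>\<^bsub>M\<^esub> B = sg_zero M" "A \<cdot>\<^bsub>M\<^esub> adjoint B = sg_zero M"
    and BA0: "adjoint B \<cdot>\<^bsub>M\<^esub> A = sg_zero M"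
    using AB M.orthogonal_sym[OF AB] by (simp_all add: M_orthogonal_iff)
  have "entrywise_join (adjoint A \<cdot>\<^bsub>M\<^esub> A) (sg_zero M) (adjoint A \<cdot>\<^bsub>M\<^esub> C)"
    using entrywise_join_mult_left[OF A B _ AB C, of "adjoint A"] by (simp add: AB0)
  then have AC: "adjoint A \<cdot>\<^bsub>M\<^esub> C = adjoint A \<cdot>\<^bsub>M\<^esub> A"
    by (rule entrywise_join_unique) (simp add: entrywise_join_zero_right)
  have "entrywise_join (sg_zero M) (adjoint B \<cdot>\<^bsub>M\<^esub> B) (adjoint B \<cdot>\<^bsub>M\<^esub> C)"
    using entrywise_join_mult_left[OF A B _ AB C, of "adjoint B"] by (simp add: BA0)
  then have BC: "adjoint B \<cdot>\<^bsub>M\<^esub> C = adjoint B \<cdot>\<^bsub>M\<^esub> B"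
    by (rule entrywise_join_unique) (simp add: entrywise_join_zero_left)
  have CA: "adjoint C \<cdot>\<^bsub>M\<^esub> A = adjoint A \<cdot>\<^bsub>M\<^esub> A" and CB: "adjoint C \<cdot>\<^bsub>M\<^esub> B = adjoint B \<cdot>\<^bsub>M\<^esub> B"
    using arg_cong[OF AC, of adjoint] arg_cong[OF BC, of adjoint] by (simp_all add: adjoint_mult)
  have CC: "entrywise_join (adjoint A \<cdot>\<^bsub>M\<^esub> A) (adjoint B \<cdot>\<^bsub>M\<^esub> B) (adjoint C \<cdot>\<^bsub>M\<^esub> C)"
    using entrywise_join_mult_left[OF A B _ AB C, of "adjoint C"] by (simp add: CA CB)
  have orth: "orthogonal M (adjoint A \<cdot>\<^bsub>M\<^esub> A) (adjoint B \<cdot>\<^bsub>M\<^esub> B)"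
  proof -
    have "adjoint A \<cdot>\<^bsub>M\<^esub> A \<cdot>\<^bsub>M\<^esub> (adjoint B \<cdot>\<^bsub>M\<^esub> B) = adjoint A \<cdot>\<^bsub>M\<^esub> (A \<cdot>\<^bsub>M\<^esub> adjoint B) \<cdot>\<^bsub>M\<^esub> B"
      by (simp add: M.sg_assoc)
    then have "adjoint A \<cdot>\<^bsub>M\<^esub> A \<cdot>\<^bsub>M\<^esub> (adjoint B \<cdot>\<^bsub>M\<^esub> B) = sg_zero M"
      by (simp add: AB0)
    then show ?thesis by (simp add: M_orthogonal_iff adjoint_mult)
  qed
  have "M.leq A C"
    by (rule M.leqI_left[of _ "A \<cdot>\<^bsub>M\<^esub> adjoint A"])
      (use M.range_idem[of A] M_regular[OF A] in \<open>simp_all add: M.sg_assoc AC\<close>)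
  moreover have "M.leq B C"
    by (rule M.leqI_left[of _ "B \<cdot>\<^bsub>M\<^esub> adjoint B"])
      (use M.range_idem[of B] M_regular[OF B] in \<open>simp_all add: M.sg_assoc BC\<close>)
  moreover have "M.leq C D" if D: "D \<in> carrier M" and AD: "M.leq A D" and BD: "M.leq B D" for D
  proof -
    have "A = D \<cdot>\<^bsub>M\<^esub> (adjoint A \<cdot>\<^bsub>M\<^esub> A)" "B = D \<cdot>\<^bsub>M\<^esub> (adjoint B \<cdot>\<^bsub>M\<^esub> B)"
      using AD BD by (simp_all add: M.leq_iff)
    then have "entrywise_join A B (D \<cdot>\<^bsub>M\<^esub> (adjoint C \<cdot>\<^bsub>M\<^esub> C))"
      using entrywise_join_mult_left[OF _ _ D orth CC] by simp
    from entrywise_join_unique[OF C this] show ?thesis by (simp add: M.leq_iff)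
  qed
  ultimately show ?thesis by (subst M.is_lub_iff) auto
qed

section \<open>Idempotent rook matrices\<close>

definition diag :: "(nat \<Rightarrow> 'a) \<Rightarrow> nat \<Rightarrow> nat \<Rightarrow> 'a"
  where "diag e = (\<lambda>i j. if i = j then e i else \<zero>)"

lemma diag_idem:
  assumes e [simp]: "\<And>i. e i \<in> E" and fin: "finite {i. e i \<noteq> \<zero>}"
  shows "diag e \<in> idempotents M"
proof -
  have carrier: "diag e \<in> carrier M"
  proof (rule M_carrierI)
    have "{(i, j). diag e i j \<noteq> \<zero>} \<subseteq> (\<lambda>i. (i, i)) ` {i. e i \<noteq> \<zero>}"
      by (auto simp: diag_def split: if_splits)
    then show "finite {(i, j). diag e i j \<noteq> \<zero>}" using fin finite_surj by blast
  qed (auto simp: diag_def)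
  have "diag e \<cdot>\<^bsub>M\<^esub> diag e = diag e"
  proof (intro ext)
    fix i j
    show "(diag e \<cdot>\<^bsub>M\<^esub> diag e) i j = diag e i j"
      by (subst M_mult_diagonal[OF carrier carrier]) (simp_all add: diag_def)
  qed
  then show ?thesis using carrier by (simp add: idempotents_def)
qed

lemma M_idem_carrier: "X \<in> idempotents M \<Longrightarrow> X \<in> carrier M"
  by (simp add: idempotents_def)

text \<open>
  An idempotent is a projection, and projections are diagonal.
\<close>

lemma M_idem_off_diagonal:
  assumes X: "X \<in> idempotents M" and "i \<noteq> j"
  shows "X i j = \<zero>"
  using M_projection_off_diagonal[OF _ \<open>i \<noteq> j\<close>, of X] M_idem_projection[of X] X
  by (simp add: idempotents_def)

lemma M_idem_entry:
  assumes X: "X \<in> idempotents M"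
  shows "X i i \<in> E"
proof (rule idemI)
  note XM = M_idem_carrier[OF X]
  show "X i i \<in> carrier S" by (rule entry_closed[OF XM])
  have "X i i = (X \<cdot>\<^bsub>M\<^esub> X) i i" using X by (simp add: idempotents_def)
  also have "\<dots> = X i i \<cdot> X i i"
    by (rule M_mult_diagonal[OF XM XM M_idem_off_diagonal[OF X]])
  finally show "X i i \<cdot> X i i = X i i" by (rule sym)
qed

lemma M_idem_finite_support:
  assumes X: "X \<in> idempotents M"
  shows "finite {i. X i i \<noteq> \<zero>}"
  using finite_vimageI[OF finite_support[OF M_idem_carrier[OF X]], of "\<lambda>i. (i, i)"]
  by (simp add: inj_on_def vimage_def)

lemma M_idem_eq_diag: "X \<in> idempotents M \<Longrightarrow> X = diag (\<lambda>i. X i i)"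
  by (intro ext) (simp add: diag_def M_idem_off_diagonal)

lemma M_idem_leqD:
  assumes X: "X \<in> idempotents M" and Y: "Y \<in> idempotents M"
    and YX: "Y \<sqsubseteq>\<^bsub>natural_order M\<^esub> X"
  shows "Y i i \<preceq> X i i"
proof -
  interpret M: inverse_semigroup_with_zero M by (rule M_inverse_semigroup_with_zero)
  have "Y = X \<cdot>\<^bsub>M\<^esub> Y" using YX M.idem_leq_iff[OF X Y] by simp
  then have "Y i i = X i i \<cdot> Y i i"
    using M_mult_diagonal[OF M_idem_carrier[OF X] M_idem_carrier[OF Y] M_idem_off_diagonal[OF X], of i i]
    by simp
  then show ?thesis using idem_leq_iff[OF M_idem_entry[OF X] M_idem_entry[OF Y]] by simp
qed

text \<open>
  Complements are taken entrywise on the diagonal. The result has finite support because the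
  complement below a zero entry is zero.
\<close>

lemma M_relative_complement:
  assumes X: "X \<in> idempotents M" and Y: "Y \<in> idempotents M"
    and YX: "Y \<sqsubseteq>\<^bsub>natural_order M\<^esub> X"
  shows "\<exists>Z\<in>idempotents M. Y \<cdot>\<^bsub>M\<^esub> Z = sg_zero M \<and> inverse_semigroup.is_lub M {Y, Z} X"
proof -
  interpret M: inverse_semigroup_with_zero M by (rule M_inverse_semigroup_with_zero)
  have "\<exists>g\<in>E. Y i i \<cdot> g = \<zero> \<and> is_lub {Y i i, g} (X i i)" for i
    using relative_complement[OF M_idem_entry[OF X] M_idem_entry[OF Y] M_idem_leqD[OF X Y YX]] .
  then obtain g where g: "\<And>i. g i \<in> E" "\<And>i. Y i i \<cdot> g i = \<zero>" "\<And>i. is_lub {Y i i, g i} (X i i)"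
    by metis
  have "g i = \<zero>" if "X i i = \<zero>" for i
  proof -
    have "{Y i i, g i} \<subseteq> carrier S" using idem_closed[OF g(1)] idem_closed[OF M_idem_entry[OF Y]] by blast
    then have "g i \<preceq> \<zero>" using g(3)[of i] unfolding that by (subst (asm) is_lub_iff) auto
    then show ?thesis using g(1) by simp
  qed
  then have "finite {i. g i \<noteq> \<zero>}"
    using finite_subset[OF _ M_idem_finite_support[OF X]] by (metis (mono_tags, lifting) mem_Collect_eq subsetI)
  then have Z: "diag g \<in> idempotents M" by (intro diag_idem g)
  note YM = M_idem_carrier[OF Y] and ZM = M_idem_carrier[OF Z]
  have YZ: "Y \<cdot>\<^bsub>M\<^esub> diag g = sg_zero M"
  proof (intro ext)
    fix i j
    have "(Y \<cdot>\<^bsub>M\<^esub> diag g) i j = Y i i \<cdot> diag g i j"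
      by (rule M_mult_diagonal[OF YM ZM M_idem_off_diagonal[OF Y]])
    then show "(Y \<cdot>\<^bsub>M\<^esub> diag g) i j = sg_zero M i j"
      using entry_closed[OF YM] g(2) by (simp add: diag_def M_zero)
  qed
  have "is_lub {Y i j, diag g i j} (X i j)" for i j
    using g(3)[of i] is_lub_zero[of "{\<zero>}"]
    by (cases "i = j") (simp_all add: diag_def M_idem_off_diagonal[OF X] M_idem_off_diagonal[OF Y])
  then have join: "entrywise_join Y (diag g) X" by (simp add: entrywise_join_def)
  have "orthogonal M Y (diag g)" using M.orthogonal_idem_iff[OF Y Z] YZ by simp
  from entrywise_join_is_lub[OF YM ZM this join] YZ Z show ?thesis by blast
qed

lemma M_orthogonally_boolean: "orthogonally_boolean_semigroup M"
proof -
  interpret M: inverse_semigroup_with_zero M by (rule M_inverse_semigroup_with_zero)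
  show ?thesis
  proof
    fix A B X C
    assume A: "A \<in> carrier M" and B: "B \<in> carrier M" and AB: "orthogonal M A B"
    have "\<forall>i j. \<exists>c. is_lub {A i j, B i j} c"
      using orthogonal_join_exists[OF entry_closed[OF A] entry_closed[OF B] orthogonal_entries(3)[OF A B AB]]
      by blast
    then obtain C' where C': "entrywise_join A B C'" unfolding entrywise_join_def by metis
    then show "\<exists>C. M.is_lub {A, B} C" using entrywise_join_is_lub[OF A B AB] by blast
    assume X: "X \<in> carrier M" and "M.is_lub {A, B} C"
    then have C: "C = C'" using entrywise_join_is_lub[OF A B AB C'] M.is_lub_unique by blast
    show "M.is_lub {X \<cdot>\<^bsub>M\<^esub> A, X \<cdot>\<^bsub>M\<^esub> B} (X \<cdot>\<^bsub>M\<^esub> C)"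
      unfolding C
      by (intro entrywise_join_is_lub M.orthogonal_mult_left entrywise_join_mult_left M.sg_closed A B X AB C')
  qed (rule M_relative_complement)
qed

text \<open>
  The second idempotent is moved along the diagonal past the support of the first. Infinitely
  many rows and columns leave the room for it.
\<close>

lemma M_orthogonally_separating:
  assumes X: "X \<in> idempotents M" and Y: "Y \<in> idempotents M"
  shows "\<exists>Y'. (Y, Y') \<in> D_relation M \<and> orthogonal M X Y'"
proof -
  interpret M: inverse_semigroup_with_zero M by (rule M_inverse_semigroup_with_zero)
  \<comment> \<open>Row \<open>n\<close> and all later rows of \<open>X\<close> vanish, so \<open>Y\<close> is shifted by \<open>n\<close>.\<close>
  obtain n where n: "\<And>i. X i i \<noteq> \<zero> \<Longrightarrow> i < n"
    using M_idem_finite_support[OF X] unfolding finite_nat_set_iff_bounded by blast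
  define A where "A = (\<lambda>i j. if i = n + j then Y j j else \<zero>)"
  have YE [simp]: "Y i i \<in> E" for i by (rule M_idem_entry[OF Y])
  have A: "A \<in> carrier M"
  proof (rule M_carrierI)
    have "{(i, j). A i j \<noteq> \<zero>} \<subseteq> (\<lambda>i. (n + i, i)) ` {i. Y i i \<noteq> \<zero>}"
      by (auto simp: A_def split: if_splits)
    then show "finite {(i, j). A i j \<noteq> \<zero>}" using M_idem_finite_support[OF Y] finite_surj by blast
  qed (auto simp: A_def)
  have "adjoint A \<cdot>\<^bsub>M\<^esub> A = Y"
  proof (intro ext)
    fix i j
    have "(adjoint A \<cdot>\<^bsub>M\<^esub> A) i j = adjoint A i (n + i) \<cdot> A (n + i) j"
      by (rule M_mult_entry_single) (use A in \<open>auto simp: A_def\<close>)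
    also have "\<dots> = Y i j"
      by (cases "i = j") (auto simp: A_def M_idem_off_diagonal[OF Y])
    finally show "(adjoint A \<cdot>\<^bsub>M\<^esub> A) i j = Y i j" .
  qed
  then have D: "(Y, A \<cdot>\<^bsub>M\<^esub> adjoint A) \<in> D_relation M"
    using M.range_idem[OF A] M.domain_idem[OF A] A unfolding D_relation_def
    by (auto simp: M_star intro!: bexI[of _ A])
  have XA: "X \<cdot>\<^bsub>M\<^esub> A = sg_zero M"
  proof (intro ext)
    fix i j
    have "(X \<cdot>\<^bsub>M\<^esub> A) i j = X i i \<cdot> A i j"
      by (rule M_mult_diagonal[OF M_idem_carrier[OF X] A M_idem_off_diagonal[OF X]])
    also have "\<dots> = \<zero>"
      using n[of i] entry_closed[OF M_idem_carrier[OF X]] entry_closed[OF A]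
      by (cases "X i i = \<zero>") (auto simp: A_def)
    finally show "(X \<cdot>\<^bsub>M\<^esub> A) i j = sg_zero M i j" by (simp add: M_zero)
  qed
  have "X \<cdot>\<^bsub>M\<^esub> (A \<cdot>\<^bsub>M\<^esub> adjoint A) = X \<cdot>\<^bsub>M\<^esub> A \<cdot>\<^bsub>M\<^esub> adjoint A"
    using A M_idem_carrier[OF X] by simp
  also have "\<dots> = sg_zero M" unfolding XA using A by simp
  finally have "orthogonal M X (A \<cdot>\<^bsub>M\<^esub> adjoint A)"
    using M.orthogonal_idem_iff[OF X] M.range_idem[OF A] by (simp add: M_star A)
  with D show ?thesis by blast
qed

end

section \<open>The monoid of classes of idempotents\<close>

text \<open>
  The construction of the type monoid, applied to any semigroup with zero in place of the rook
  matrices, so that the rest of the argument need not mention matrices.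
\<close>

definition D_class_monoid :: "('a, 'b) semigroup_with_zero_scheme \<Rightarrow> 'a set monoid" where
  "D_class_monoid S =
     \<lparr>carrier = idempotents S // D_relation S,
      mult = (\<lambda>P Q. THE R. \<exists>e' \<in> P. \<exists>f' \<in> Q. orthogonal S e' f' \<and>
                 R = D_relation S `` {e' \<squnion>\<^bsub>natural_order S\<^esub> f'}),
      one = D_relation S `` {sg_zero S}\<rparr>"

lemma type_monoid_eq_D_class_monoid: "type_monoid S = D_class_monoid (rook_matrices S)"
  by (simp add: type_monoid_def D_class_monoid_def Let_def)

context inverse_semigroup
begin

abbreviation D :: "('a \<times> 'a) set" where "D \<equiv> D_relation S"

abbreviation D_class :: "'a \<Rightarrow> 'a set" where "D_class e \<equiv> D `` {e}"

lemma D_I: "a \<in> carrier S \<Longrightarrow> (a\<^sup>\<star> \<cdot> a, a \<cdot> a\<^sup>\<star>) \<in> D"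
  unfolding D_relation_def by auto

lemma D_E:
  assumes "(e, f) \<in> D"
  obtains a where "a \<in> carrier S" "a\<^sup>\<star> \<cdot> a = e" "a \<cdot> a\<^sup>\<star> = f"
  using assms unfolding D_relation_def by blast

lemma D_idem: "(e, f) \<in> D \<Longrightarrow> e \<in> E \<and> f \<in> E"
  unfolding D_relation_def by blast

lemma D_refl: "e \<in> E \<Longrightarrow> (e, e) \<in> D"
  using D_I[of e] by simp

lemma D_sym: "(e, f) \<in> D \<Longrightarrow> (f, e) \<in> D"
proof (elim D_E)
  fix a assume "a \<in> carrier S" "a\<^sup>\<star> \<cdot> a = e" "a \<cdot> a\<^sup>\<star> = f"
  then show "(f, e) \<in> D" using D_I[of "a\<^sup>\<star>"] by simp
qed

lemma D_trans:
  assumes "(e, f) \<in> D" "(f, g) \<in> D"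
  shows "(e, g) \<in> D"
proof -
  obtain a where a [simp]: "a \<in> carrier S" and e: "a\<^sup>\<star> \<cdot> a = e" and f: "a \<cdot> a\<^sup>\<star> = f"
    using assms(1) by (rule D_E)
  obtain b where b [simp]: "b \<in> carrier S" and f': "b\<^sup>\<star> \<cdot> b = f" and g: "b \<cdot> b\<^sup>\<star> = g"
    using assms(2) by (rule D_E)
  have "(b \<cdot> a)\<^sup>\<star> \<cdot> (b \<cdot> a) = a\<^sup>\<star> \<cdot> (b\<^sup>\<star> \<cdot> b) \<cdot> a" by simp
  also have "\<dots> = a\<^sup>\<star> \<cdot> (a \<cdot> a\<^sup>\<star>) \<cdot> a" unfolding f' f ..
  also have "\<dots> = e" using e by simp
  finally have 1: "(b \<cdot> a)\<^sup>\<star> \<cdot> (b \<cdot> a) = e" .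
  have "(b \<cdot> a) \<cdot> (b \<cdot> a)\<^sup>\<star> = b \<cdot> (a \<cdot> a\<^sup>\<star>) \<cdot> b\<^sup>\<star>" by simp
  also have "\<dots> = b \<cdot> (b\<^sup>\<star> \<cdot> b) \<cdot> b\<^sup>\<star>" unfolding f' f ..
  also have "\<dots> = g" using g by simp
  finally show ?thesis using 1 D_I[of "b \<cdot> a"] by simp
qed

lemma equiv_D: "equiv E D"
  by (rule equivI) (auto simp: refl_on_def D_refl dest: D_idem intro!: symI transI intro: D_sym D_trans)

lemma D_class_eq_iff: "\<lbrakk>e \<in> E; f \<in> E\<rbrakk> \<Longrightarrow> D_class e = D_class f \<longleftrightarrow> (e, f) \<in> D"
  using eq_equiv_class_iff[OF equiv_D] .

end

context orthogonally_boolean_semigroup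
begin

lemma D_zero: "(e, \<zero>) \<in> D \<Longrightarrow> e = \<zero>"
proof (elim D_E)
  fix a assume [simp]: "a \<in> carrier S" and "a\<^sup>\<star> \<cdot> a = e" "a \<cdot> a\<^sup>\<star> = \<zero>"
  moreover from this(3) have "a\<^sup>\<star> = \<zero>" using star_regular'[of a] by simp
  ultimately show "e = \<zero>" by simp
qed

text \<open>
  If \<open>a\<close> leads from \<open>e\<close> to \<open>e'\<close> and \<open>b\<close> from \<open>f\<close> to \<open>f'\<close>, then \<open>a\<close> and \<open>b\<close> are
  orthogonal because their domains and ranges are, and the join of \<open>a\<close> and \<open>b\<close> leads from
  \<open>s\<close> to \<open>s'\<close>. This makes the addition of classes well defined.
\<close>

lemma D_orthogonal_join:
  assumes "(e, e') \<in> D" "(f, f') \<in> D" and ef: "e \<cdot> f = \<zero>" and ef': "e' \<cdot> f' = \<zero>"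
    and s: "is_lub {e, f} s" and s': "is_lub {e', f'} s'"
  shows "(s, s') \<in> D"
proof -
  obtain a where a [simp]: "a \<in> carrier S" and e: "a\<^sup>\<star> \<cdot> a = e" and e': "a \<cdot> a\<^sup>\<star> = e'"
    using assms(1) by (rule D_E)
  obtain b where b [simp]: "b \<in> carrier S" and f: "b\<^sup>\<star> \<cdot> b = f" and f': "b \<cdot> b\<^sup>\<star> = f'"
    using assms(2) by (rule D_E)
  have "a\<^sup>\<star> \<cdot> b = a\<^sup>\<star> \<cdot> (a \<cdot> a\<^sup>\<star> \<cdot> (b \<cdot> b\<^sup>\<star>)) \<cdot> b" by simp
  also have "\<dots> = \<zero>" unfolding e' f' ef' by simp
  finally have ab: "a\<^sup>\<star> \<cdot> b = \<zero>" .
  have "a \<cdot> b\<^sup>\<star> = a \<cdot> (a\<^sup>\<star> \<cdot> a \<cdot> (b\<^sup>\<star> \<cdot> b)) \<cdot> b\<^sup>\<star>" by simp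
  also have "\<dots> = \<zero>" unfolding e f ef by simp
  finally have ab': "a \<cdot> b\<^sup>\<star> = \<zero>" .
  have orth: "orthogonal S a b" using ab ab' by (simp add: orthogonal_def)
  have orth': "orthogonal S (a\<^sup>\<star>) (b\<^sup>\<star>)" using ab ab' by (simp add: orthogonal_def)
  obtain c where c: "is_lub {a, b} c" using orthogonal_join_exists[OF a b orth] by blast
  have [simp]: "c \<in> carrier S" by (rule is_lub_closed[OF c])
  have c': "is_lub {a\<^sup>\<star>, b\<^sup>\<star>} (c\<^sup>\<star>)" using is_lub_star[OF c] by simp
  have [simp]: "e' \<in> carrier S" "f' \<in> carrier S"
    using D_idem[OF assms(1)] D_idem[OF assms(2)] by simp_all
  have ba: "b\<^sup>\<star> \<cdot> a = \<zero>" "b \<cdot> a\<^sup>\<star> = \<zero>"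
    using orthogonal_sym[OF orth] by (simp_all add: orthogonal_def)
  have "a\<^sup>\<star> \<cdot> c = a\<^sup>\<star> \<cdot> a" "b\<^sup>\<star> \<cdot> c = b\<^sup>\<star> \<cdot> b"
    using orthogonal_distrib_left[OF a b _ orth c, of "a\<^sup>\<star>"]
      orthogonal_distrib_left[OF a b _ orth c, of "b\<^sup>\<star>"]
    by (simp_all add: ab ba is_lub_pair_zero)
  then have "c\<^sup>\<star> \<cdot> a = e" "c\<^sup>\<star> \<cdot> b = f"
    using star_mult[of "a\<^sup>\<star>" c] star_mult[of "b\<^sup>\<star>" c] by (simp_all add: e f flip: e f)
  then have "is_lub {e, f} (c\<^sup>\<star> \<cdot> c)"
    using orthogonal_distrib_left[OF a b _ orth c, of "c\<^sup>\<star>"] by simp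
  then have 1: "c\<^sup>\<star> \<cdot> c = s" using s is_lub_unique by blast
  have "a \<cdot> c\<^sup>\<star> = e'" "b \<cdot> c\<^sup>\<star> = f'"
    using orthogonal_distrib_left[OF _ _ _ orth' c', of a]
      orthogonal_distrib_left[OF _ _ _ orth' c', of b]
    by (simp_all add: ab' ba is_lub_pair_zero e' f')
  then have "is_lub {e', f'} (c \<cdot> c\<^sup>\<star>)"
    using orthogonal_distrib_right[OF a b _ orth c, of "c\<^sup>\<star>"] by simp
  then have 2: "c \<cdot> c\<^sup>\<star> = s'" using s' is_lub_unique by blast
  show ?thesis using D_I[of c] 1 2 by simp
qed

lemma orthogonal_join_idem:
  assumes e: "e \<in> E" and f: "f \<in> E" and ef: "e \<cdot> f = \<zero>" and s: "is_lub {e, f} s"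
  shows "s \<in> E"
  using D_orthogonal_join[OF D_refl[OF e] D_refl[OF f] ef ef s s] D_idem by blast

abbreviation T :: "'a set monoid" where "T \<equiv> D_class_monoid S"

lemma D_class_mult:
  assumes e: "e \<in> E" and f: "f \<in> E" and ef: "e \<cdot> f = \<zero>" and s: "is_lub {e, f} s"
  shows "D_class e \<otimes>\<^bsub>T\<^esub> D_class f = D_class s"
proof -
  let ?R = "\<lambda>R. \<exists>e' \<in> D_class e. \<exists>f' \<in> D_class f. orthogonal S e' f' \<and>
                 R = D_class (e' \<squnion>\<^bsub>natural_order S\<^esub> f')"
  have sE: "s \<in> E" by (rule orthogonal_join_idem[OF assms])
  have "(THE R. ?R R) = D_class s"
  proof (rule the_equality)
    have "D_class s = D_class (e \<squnion>\<^bsub>natural_order S\<^esub> f)" by (simp add: join_def Sup_eqI[OF s])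
    then show "?R (D_class s)"
      using D_refl[OF e] D_refl[OF f] ef orthogonal_idem_iff[OF e f] by blast
  next
    fix R assume "?R R"
    then obtain e' f' where e': "(e, e') \<in> D" and f': "(f, f') \<in> D" and orth: "orthogonal S e' f'"
      and R: "R = D_class (e' \<squnion>\<^bsub>natural_order S\<^esub> f')" by blast
    have e'E: "e' \<in> E" and f'E: "f' \<in> E" using D_idem e' f' by blast+
    obtain s' where s': "is_lub {e', f'} s'"
      using orthogonal_join_exists[OF _ _ orth] e'E f'E by auto
    have "e' \<cdot> f' = \<zero>" using orth orthogonal_idem_iff[OF e'E f'E] by simp
    then have "(s, s') \<in> D" by (rule D_orthogonal_join[OF e' f' ef _ s s'])
    then show "R = D_class s"
      unfolding R join_def Sup_eqI[OF s'] using D_class_eq_iff sE D_idem by blast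
  qed
  then show ?thesis by (simp add: D_class_monoid_def)
qed

lemma T_carrier: "carrier T = E // D"
  by (simp add: D_class_monoid_def)

lemma D_class_closed: "e \<in> E \<Longrightarrow> D_class e \<in> carrier T"
  by (simp add: T_carrier quotientI)

lemma T_carrierE:
  assumes "P \<in> carrier T"
  obtains e where "e \<in> E" "P = D_class e"
  using assms unfolding T_carrier by (rule quotientE)

lemma idem_mult_leq: "\<lbrakk>e \<in> E; f \<in> E\<rbrakk> \<Longrightarrow> e \<cdot> f \<preceq> e \<and> e \<cdot> f \<preceq> f"
  by (auto intro: leqI_left[of _ e] leqI_right[of _ f])

text \<open>
  Everything below an orthogonal join of idempotents splits into its parts below the two.
\<close>

lemma idem_leq_join:
  assumes e: "e \<in> E" and f: "f \<in> E" and ef: "e \<cdot> f = \<zero>" and s: "is_lub {e, f} s"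
    and x: "x \<in> E" "x \<preceq> s"
  shows "is_lub {e \<cdot> x, f \<cdot> x} x"
proof -
  have "orthogonal S e f" using ef orthogonal_idem_iff[OF e f] by simp
  then have "is_lub {e \<cdot> x, f \<cdot> x} (s \<cdot> x)"
    using orthogonal_distrib_right[OF _ _ _ _ s] e f x(1) by simp
  then show ?thesis
    using x idem_leq_iff[OF orthogonal_join_idem[OF e f ef s] x(1)] by simp
qed

section \<open>Additive length functions\<close>

text \<open>
  An idempotent \<open>e\<close> with an idempotent \<open>f\<close> strictly between \<open>\<zero>\<close> and itself is the orthogonal
  join of \<open>f\<close> and a non-zero complement \<open>g\<close>, both of smaller length. Every idempotent below
  \<open>e\<close> is the join of its parts below \<open>f\<close> and \<open>g\<close>, so the number of idempotents below
  \<open>e\<close> is finite by induction on the length.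
\<close>

lemma finite_downset_if_length:
  fixes l :: "'a \<Rightarrow> nat"
  assumes additive: "\<And>e f s. \<lbrakk>e \<in> E; f \<in> E; e \<cdot> f = \<zero>; is_lub {e, f} s\<rbrakk> \<Longrightarrow> l s = l e + l f"
    and positive: "\<And>e. \<lbrakk>e \<in> E; l e = 0\<rbrakk> \<Longrightarrow> e = \<zero>"
  shows "e \<in> E \<Longrightarrow> finite {x \<in> E. x \<preceq> e}"
proof (induction "l e" arbitrary: e rule: less_induct)
  case less
  show ?case
  proof (cases "\<exists>f\<in>E. f \<preceq> e \<and> f \<noteq> \<zero> \<and> f \<noteq> e")
    case False
    then have "{x \<in> E. x \<preceq> e} \<subseteq> {\<zero>, e}" by blast
    then show ?thesis using finite_subset by blast
  next
    case True
    then obtain f where f: "f \<in> E" "f \<preceq> e" "f \<noteq> \<zero>" "f \<noteq> e" by blast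
    obtain g where g: "g \<in> E" "f \<cdot> g = \<zero>" "is_lub {f, g} e"
      using relative_complement[OF less.prems f(1,2)] by blast
    have "g \<noteq> \<zero>"
      using g(3) f(1,4) is_lub_pair_zero by auto
    then have "l f < l e" "l g < l e"
      using additive[OF f(1) g] positive f(1,3) g(1) by fastforce+
    then have "finite {x \<in> E. x \<preceq> f}" "finite {x \<in> E. x \<preceq> g}"
      using less.hyps f(1) g(1) by blast+
    then have "finite ((\<lambda>(x, y). \<Squnion>\<^bsub>natural_order S\<^esub> {x, y}) ` ({x \<in> E. x \<preceq> f} \<times> {x \<in> E. x \<preceq> g}))"
      by blast
    moreover have "x \<in> (\<lambda>(x, y). \<Squnion>\<^bsub>natural_order S\<^esub> {x, y}) ` ({x \<in> E. x \<preceq> f} \<times> {x \<in> E. x \<preceq> g})"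
      if x: "x \<in> E" "x \<preceq> e" for x
    proof -
      have "\<Squnion>\<^bsub>natural_order S\<^esub> {f \<cdot> x, g \<cdot> x} = x"
        by (rule Sup_eqI[OF idem_leq_join[OF f(1) g x]])
      moreover have "(f \<cdot> x, g \<cdot> x) \<in> {x \<in> E. x \<preceq> f} \<times> {x \<in> E. x \<preceq> g}"
        using idem_mult_leq f(1) g(1) x(1) by simp
      ultimately show ?thesis by (metis (mono_tags, lifting) case_prod_conv image_eqI)
    qed
    ultimately show ?thesis by (elim rev_finite_subset) blast
  qed
qed

text \<open>
  The size of multisets is an additive length on the free abelian monoid, and only the empty
  multiset has size zero. It pulls back to idempotents, since only \<open>\<zero>\<close> is \<open>D\<close>-related to \<open>\<zero>\<close>.
\<close>

lemma finite_downset_if_free: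
  assumes "T \<cong> free_abelian_monoid X" and e: "e \<in> E"
  shows "finite {x \<in> E. x \<preceq> e}"
proof -
  obtain h where hom: "h \<in> hom T (free_abelian_monoid X)"
    and bij: "bij_betw h (carrier T) (carrier (free_abelian_monoid X))"
    using assms(1) by (auto simp: is_iso_def iso_def)
  have add: "h (D_class s) = h (D_class e) + h (D_class f)"
    if "e \<in> E" "f \<in> E" "e \<cdot> f = \<zero>" "is_lub {e, f} s" for e f s
    using hom_mult[OF hom D_class_closed D_class_closed, of e f] that
    by (simp add: D_class_mult free_abelian_monoid_def)
  have h0: "h (D_class \<zero>) = {#}"
    using add[of \<zero> \<zero> \<zero>] by (simp add: is_lub_singleton)
  show ?thesis
  proof (rule finite_downset_if_length[of "\<lambda>e. size (h (D_class e))", OF _ _ e])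
    show "size (h (D_class s)) = size (h (D_class e)) + size (h (D_class f))"
      if "e \<in> E" "f \<in> E" "e \<cdot> f = \<zero>" "is_lub {e, f} s" for e f s
      by (simp add: add[OF that])
    show "e = \<zero>" if "e \<in> E" "size (h (D_class e)) = 0" for e
    proof -
      have "h (D_class e) = h (D_class \<zero>)" using that h0 by simp
      then have "D_class e = D_class \<zero>"
        using bij D_class_closed[OF that(1)] D_class_closed[OF zero_idem]
        by (auto simp: bij_betw_def dest: inj_onD)
      then show ?thesis using D_class_eq_iff[OF that(1) zero_idem] D_zero by blast
    qed
  qed
qed

end

section \<open>Atoms\<close>

context orthogonally_boolean_semigroup
begin

definition atom :: "'a \<Rightarrow> bool"
  where "atom a \<longleftrightarrow> a \<in> E \<and> a \<noteq> \<zero> \<and> (\<forall>x\<in>E. x \<preceq> a \<longrightarrow> x = \<zero> \<or> x = a)"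

definition atoms_below :: "'a \<Rightarrow> 'a set"
  where "atoms_below e = {a. atom a \<and> a \<preceq> e}"

definition atom_classes :: "'a \<Rightarrow> 'a set multiset"
  where "atom_classes e = image_mset D_class (mset_set (atoms_below e))"

lemma atom_idem: "atom a \<Longrightarrow> a \<in> E"
  by (simp add: atom_def)

lemma atoms_below_self: "atom a \<Longrightarrow> atoms_below a = {a}"
  by (auto simp: atoms_below_def atom_def)

lemma exists_atom_below:
  assumes "e \<in> E" "e \<noteq> \<zero>" "finite {x \<in> E. x \<preceq> e}"
  shows "\<exists>a. atom a \<and> a \<preceq> e"
  using assms
proof (induction "card {x \<in> E. x \<preceq> e}" arbitrary: e rule: less_induct)
  case less
  show ?case
  proof (cases "atom e")
    case True
    then show ?thesis using less.prems(1) by auto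
  next
    case False
    then obtain f where f: "f \<in> E" "f \<preceq> e" "f \<noteq> \<zero>" "f \<noteq> e"
      using less.prems unfolding atom_def by blast
    have trans: "x \<preceq> e" if "x \<in> E" "x \<preceq> f" for x
      using leq_trans[OF that(2) f(2)] that(1) f(1) less.prems(1) by simp
    have "e \<notin> {x \<in> E. x \<preceq> f}"
      using leq_antisym[of e f] f less.prems(1) by auto
    then have "{x \<in> E. x \<preceq> f} \<subset> {x \<in> E. x \<preceq> e}"
      using trans less.prems(1) by auto
    then have "card {x \<in> E. x \<preceq> f} < card {x \<in> E. x \<preceq> e}" "finite {x \<in> E. x \<preceq> f}"
      using less.prems(3) psubset_card_mono finite_subset by blast+
    then obtain a where "atom a" "a \<preceq> f" using less.hyps f by blast
    then show ?thesis using trans atom_idem by blast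
  qed
qed

text \<open>
  An atom below the join is the join of its parts below \<open>e\<close> and \<open>f\<close>. Each part is zero or
  the whole atom, and not both are zero.
\<close>

lemma atoms_below_join:
  assumes e: "e \<in> E" and f: "f \<in> E" and ef: "e \<cdot> f = \<zero>" and s: "is_lub {e, f} s"
  shows "atoms_below s = atoms_below e \<union> atoms_below f" "atoms_below e \<inter> atoms_below f = {}"
proof -
  have sE: "s \<in> E" by (rule orthogonal_join_idem[OF assms])
  have es: "e \<preceq> s" "f \<preceq> s" using s e f by (simp_all add: is_lub_iff)
  have "atoms_below s \<subseteq> atoms_below e \<union> atoms_below f"
  proof
    fix a assume "a \<in> atoms_below s"
    then have a: "atom a" and as: "a \<preceq> s" and aE: "a \<in> E" by (auto simp: atoms_below_def atom_def)
    have lub: "is_lub {e \<cdot> a, f \<cdot> a} a" by (rule idem_leq_join[OF assms aE as])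
    have "g \<cdot> a = \<zero> \<or> g \<cdot> a = a" if "g \<in> E" for g
      using a idem_mult_leq[OF that aE] that aE by (simp add: atom_def)
    then have "e \<cdot> a = a \<or> f \<cdot> a = a \<or> e \<cdot> a = \<zero> \<and> f \<cdot> a = \<zero>" using e f by blast
    moreover have "\<not> (e \<cdot> a = \<zero> \<and> f \<cdot> a = \<zero>)"
      using lub a is_lub_zero[of "{\<zero>}" a] by (auto simp: atom_def)
    ultimately show "a \<in> atoms_below e \<union> atoms_below f"
      using a idem_leq_iff[OF e aE] idem_leq_iff[OF f aE] by (auto simp: atoms_below_def)
  qed
  moreover have "atoms_below g \<subseteq> atoms_below s" if "g \<in> E" "g \<preceq> s" for g
    using leq_trans[OF _ that(2)] that(1) sE atom_idem by (auto simp: atoms_below_def)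
  ultimately show "atoms_below s = atoms_below e \<union> atoms_below f" using e f es by blast
  show "atoms_below e \<inter> atoms_below f = {}"
  proof (rule ccontr)
    assume "atoms_below e \<inter> atoms_below f \<noteq> {}"
    then obtain a where a: "atom a" "a \<preceq> e" "a \<preceq> f" by (auto simp: atoms_below_def)
    note aE = atom_idem[OF a(1)]
    have "a = e \<cdot> (f \<cdot> a)" using a aE idem_leq_iff e f by metis
    also have "\<dots> = e \<cdot> f \<cdot> a" using e f aE by simp
    also have "\<dots> = \<zero>" unfolding ef using aE by simp
    finally show False using a by (simp add: atom_def)
  qed
qed

text \<open>
  Conjugation by \<open>a\<close> maps the idempotents below \<open>e\<close> isomorphically onto those below the range
  of \<open>a\<close>, with conjugation by the inverse of \<open>a\<close> as its inverse, so it preserves atoms. The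
  restriction \<open>a \<cdot> x\<close> shows that it stays within \<open>D\<close>-classes.
\<close>

lemma atom_conj:
  assumes [simp]: "a \<in> carrier S" and e: "a\<^sup>\<star> \<cdot> a = e" and x: "x \<in> atoms_below e"
  shows "a \<cdot> (x \<cdot> a\<^sup>\<star>) \<in> atoms_below (a \<cdot> a\<^sup>\<star>)" "(x, a \<cdot> (x \<cdot> a\<^sup>\<star>)) \<in> D"
    "a\<^sup>\<star> \<cdot> (a \<cdot> (x \<cdot> a\<^sup>\<star>) \<cdot> a) = x"
proof -
  have x': "atom x" "x \<preceq> e" and xE [simp]: "x \<in> E" using x by (auto simp: atoms_below_def atom_def)
  have eE [simp]: "e \<in> E" using e by auto
  have ex: "e \<cdot> x = x" using x'(2) idem_leq_iff[OF eE xE] by simp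
  then have xe: "x \<cdot> e = x" using idem_commute[OF eE xE] by simp
  have "a\<^sup>\<star> \<cdot> (a \<cdot> (x \<cdot> a\<^sup>\<star>) \<cdot> a) = a\<^sup>\<star> \<cdot> a \<cdot> (x \<cdot> (a\<^sup>\<star> \<cdot> a))" by simp
  then show conj_back: "a\<^sup>\<star> \<cdot> (a \<cdot> (x \<cdot> a\<^sup>\<star>) \<cdot> a) = x" unfolding e xe ex .
  have "(a \<cdot> x)\<^sup>\<star> \<cdot> (a \<cdot> x) = x \<cdot> (a\<^sup>\<star> \<cdot> a \<cdot> x)" by simp
  also have "\<dots> = x" unfolding e ex by simp
  finally show "(x, a \<cdot> (x \<cdot> a\<^sup>\<star>)) \<in> D" using D_I[of "a \<cdot> x"] by simp
  have "atom (a \<cdot> (x \<cdot> a\<^sup>\<star>))"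
    unfolding atom_def
  proof (intro conjI ballI impI)
    show "a \<cdot> (x \<cdot> a\<^sup>\<star>) \<noteq> \<zero>"
    proof
      assume "a \<cdot> (x \<cdot> a\<^sup>\<star>) = \<zero>"
      then have "x = \<zero>" using conj_back by (simp del: sg_assoc)
      then show False using x'(1) by (simp add: atom_def)
    qed
  next
    fix y assume y [simp]: "y \<in> E" and le: "y \<preceq> a \<cdot> (x \<cdot> a\<^sup>\<star>)"
    have y': "y = a \<cdot> (x \<cdot> a\<^sup>\<star>) \<cdot> y" using le idem_leq_iff[of "a \<cdot> (x \<cdot> a\<^sup>\<star>)" y] by simp
    have "a \<cdot> a\<^sup>\<star> \<cdot> y = a \<cdot> a\<^sup>\<star> \<cdot> (a \<cdot> (x \<cdot> a\<^sup>\<star>) \<cdot> y)" by (rule arg_cong[OF y'])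
    also have "\<dots> = a \<cdot> (x \<cdot> a\<^sup>\<star>) \<cdot> y" by simp
    also note y'[symmetric]
    finally have aa: "a \<cdot> a\<^sup>\<star> \<cdot> y = y" .
    have ya: "y \<cdot> (a \<cdot> a\<^sup>\<star>) = y" using aa idem_commute[of y "a \<cdot> a\<^sup>\<star>"] by simp
    have "a\<^sup>\<star> \<cdot> (y \<cdot> a) \<preceq> a\<^sup>\<star> \<cdot> (a \<cdot> (x \<cdot> a\<^sup>\<star>) \<cdot> a)"
      by (intro mult_left_mono mult_right_mono le) simp_all
    then have "a\<^sup>\<star> \<cdot> (y \<cdot> a) \<preceq> x" unfolding conj_back .
    then have cases: "a\<^sup>\<star> \<cdot> (y \<cdot> a) = \<zero> \<or> a\<^sup>\<star> \<cdot> (y \<cdot> a) = x" using x'(1) by (simp add: atom_def)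
    have y_conj: "y = a \<cdot> (a\<^sup>\<star> \<cdot> (y \<cdot> a) \<cdot> a\<^sup>\<star>)"
    proof -
      have "a \<cdot> (a\<^sup>\<star> \<cdot> (y \<cdot> a) \<cdot> a\<^sup>\<star>) = a \<cdot> a\<^sup>\<star> \<cdot> (y \<cdot> (a \<cdot> a\<^sup>\<star>))" by simp
      then show ?thesis unfolding ya aa ..
    qed
    from cases show "y = \<zero> \<or> y = a \<cdot> (x \<cdot> a\<^sup>\<star>)"
    proof (elim disjE)
      assume z: "a\<^sup>\<star> \<cdot> (y \<cdot> a) = \<zero>"
      show ?thesis using y_conj unfolding z by simp
    next
      assume z: "a\<^sup>\<star> \<cdot> (y \<cdot> a) = x"
      show ?thesis using y_conj unfolding z by (rule disjI2)
    qed
  qed simp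
  moreover have "a \<cdot> (x \<cdot> a\<^sup>\<star>) \<preceq> a \<cdot> a\<^sup>\<star>"
    by (rule leqI_right[of _ "a \<cdot> (x \<cdot> a\<^sup>\<star>)"]) simp_all
  ultimately show "a \<cdot> (x \<cdot> a\<^sup>\<star>) \<in> atoms_below (a \<cdot> a\<^sup>\<star>)" by (simp add: atoms_below_def)
qed

lemma atom_classes_D_invariant:
  assumes "(e, f) \<in> D"
  shows "atom_classes e = atom_classes f"
proof -
  obtain a where a [simp]: "a \<in> carrier S" and e: "a\<^sup>\<star> \<cdot> a = e" and f: "a \<cdot> a\<^sup>\<star> = f"
    using assms by (rule D_E)
  let ?g = "\<lambda>x. a \<cdot> (x \<cdot> a\<^sup>\<star>)" and ?h = "\<lambda>y. a\<^sup>\<star> \<cdot> (y \<cdot> a)"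
  note fwd = atom_conj[OF a e, unfolded f]
  have f': "a\<^sup>\<star>\<^sup>\<star> \<cdot> a\<^sup>\<star> = f" using f by simp
  note bwd = atom_conj[OF star_closed[OF a] f', simplified star_star[OF a] e]
  have bij: "bij_betw ?g (atoms_below e) (atoms_below f)"
    by (rule bij_betw_byWitness[where f' = ?h]) (use fwd bwd in \<open>auto simp del: sg_assoc\<close>)
  have "atom_classes f = image_mset D_class (mset_set (?g ` atoms_below e))"
    using bij by (simp add: atom_classes_def bij_betw_def)
  also have "\<dots> = image_mset D_class (image_mset ?g (mset_set (atoms_below e)))"
    using bij by (simp add: bij_betw_def image_mset_mset_set)
  also have "\<dots> = image_mset (\<lambda>x. D_class (?g x)) (mset_set (atoms_below e))"
    by (simp add: multiset.map_comp comp_def)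
  also have "\<dots> = atom_classes e"
    unfolding atom_classes_def
  proof (rule image_mset_cong)
    fix x assume "x \<in># mset_set (atoms_below e)"
    then have x: "x \<in> atoms_below e" by (metis elem_mset_set infinite_set_mset_mset_set empty_iff)
    then have "(x, ?g x) \<in> D" by (rule fwd(2))
    then show "D_class (?g x) = D_class x" using D_class_eq_iff D_idem by blast
  qed
  finally show ?thesis by (rule sym)
qed

end

section \<open>Free monoids of classes\<close>

locale atomic_separating_semigroup = orthogonally_boolean_semigroup +
  assumes separating: "\<lbrakk>e \<in> E; f \<in> E\<rbrakk> \<Longrightarrow> \<exists>f'. (f, f') \<in> D \<and> orthogonal S e f'"
    and finite_downsets: "e \<in> E \<Longrightarrow> finite {x \<in> E. x \<preceq> e}"
begin

lemma finite_atoms_below: "e \<in> E \<Longrightarrow> finite (atoms_below e)"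
  by (rule finite_subset[OF _ finite_downsets]) (auto simp: atoms_below_def atom_def)

lemma atom_classes_join:
  assumes "e \<in> E" "f \<in> E" "e \<cdot> f = \<zero>" "is_lub {e, f} s"
  shows "atom_classes s = atom_classes e + atom_classes f"
  using atoms_below_join[OF assms] assms(1,2)
  by (simp add: atom_classes_def mset_set_Union finite_atoms_below)

lemma atom_classes_eq_empty:
  assumes "e \<in> E" "atom_classes e = {#}"
  shows "e = \<zero>"
proof (rule ccontr)
  assume "e \<noteq> \<zero>"
  then obtain a where "a \<in> atoms_below e"
    using exists_atom_below assms(1) finite_downsets by (auto simp: atoms_below_def)
  then show False
    using assms finite_atoms_below[OF assms(1)] by (auto simp: atom_classes_def mset_set_empty_iff)
qed

lemma atom_classes_zero: "atom_classes \<zero> = {#}"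
proof -
  have "atoms_below \<zero> = {}" using atom_idem by (auto simp: atoms_below_def atom_def)
  then show ?thesis by (simp add: atom_classes_def)
qed

lemma atom_classes_atom: "atom a \<Longrightarrow> atom_classes a = {#D_class a#}"
  by (simp add: atom_classes_def atoms_below_self)

text \<open>
  Removing an atom from \<open>e\<close> and a \<open>D\<close>-related atom from \<open>f\<close> leaves complements that still have
  equal multisets of atom classes; they are \<open>D\<close>-related by induction, and so are the
  orthogonal joins with the removed atoms.
\<close>

lemma D_if_atom_classes_eq:
  "\<lbrakk>e \<in> E; f \<in> E; atom_classes e = atom_classes f\<rbrakk> \<Longrightarrow> (e, f) \<in> D"
proof (induction "size (atom_classes e)" arbitrary: e f rule: less_induct)
  case less
  note e = less.prems(1) and f = less.prems(2) and eq = less.prems(3)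
  show ?case
  proof (cases "e = \<zero>")
    case True
    then have "f = \<zero>" using eq atom_classes_zero atom_classes_eq_empty[OF f] by simp
    then show ?thesis using True D_refl e by simp
  next
    case False
    then obtain a where a: "atom a" "a \<preceq> e"
      using exists_atom_below e finite_downsets by blast
    then have "D_class a \<in># atom_classes e"
      using finite_atoms_below[OF e] by (simp add: atom_classes_def atoms_below_def)
    then obtain b where b: "atom b" "b \<preceq> f" and ab: "D_class a = D_class b"
      using finite_atoms_below[OF f] unfolding eq by (auto simp: atom_classes_def atoms_below_def)
    note aE = atom_idem[OF a(1)] and bE = atom_idem[OF b(1)]
    obtain e' where e': "e' \<in> E" "a \<cdot> e' = \<zero>" "is_lub {a, e'} e"
      using relative_complement[OF e aE a(2)] by blast
    obtain f' where f': "f' \<in> E" "b \<cdot> f' = \<zero>" "is_lub {b, f'} f"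
      using relative_complement[OF f bE b(2)] by blast
    have 1: "atom_classes e = add_mset (D_class a) (atom_classes e')"
      using atom_classes_join[OF aE e'] atom_classes_atom[OF a(1)] by simp
    have 2: "atom_classes f = add_mset (D_class a) (atom_classes f')"
      using atom_classes_join[OF bE f'] atom_classes_atom[OF b(1)] ab by simp
    have "(e', f') \<in> D"
      by (rule less.hyps) (use 1 2 eq e'(1) f'(1) in simp_all)
    moreover have "(a, b) \<in> D" using D_class_eq_iff[OF aE bE] ab by simp
    ultimately show ?thesis using D_orthogonal_join e'(2,3) f'(2,3) by blast
  qed
qed

text \<open>
  The sum of two classes is computed on an orthogonal pair of representatives, which the
  separation axiom provides.
\<close>

lemma separated_sum:
  assumes e: "e \<in> E" and f: "f \<in> E"
  obtains s where "s \<in> E" "D_class e \<otimes>\<^bsub>T\<^esub> D_class f = D_class s"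
    "atom_classes s = atom_classes e + atom_classes f"
proof -
  obtain f' where ff': "(f, f') \<in> D" and orth: "orthogonal S e f'" using separating[OF e f] by blast
  have f': "f' \<in> E" using D_idem[OF ff'] by blast
  have ef': "e \<cdot> f' = \<zero>" using orth orthogonal_idem_iff[OF e f'] by simp
  obtain s where s: "is_lub {e, f'} s" using orthogonal_join_exists[OF _ _ orth] e f' by auto
  show thesis
  proof (rule that[of s])
    show "s \<in> E" by (rule orthogonal_join_idem[OF e f' ef' s])
    have "D_class f = D_class f'" using D_class_eq_iff[OF f f'] ff' by simp
    then show "D_class e \<otimes>\<^bsub>T\<^esub> D_class f = D_class s"
      using D_class_mult[OF e f' ef' s] by simp
    show "atom_classes s = atom_classes e + atom_classes f"
      using atom_classes_join[OF e f' ef' s] atom_classes_D_invariant[OF ff'] by simp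
  qed
qed

text \<open>
  The isomorphism sends the class of \<open>e\<close> to the multiset of classes of the atoms below \<open>e\<close>.
\<close>

lemma D_class_monoid_free: "T \<cong> free_abelian_monoid (D_class ` {a. atom a})"
proof -
  let ?X = "D_class ` {a. atom a}"
  \<comment> \<open>The choice of the representative is immaterial, by invariance of \<open>atom_classes\<close> under \<open>D\<close>.\<close>
  define h where "h P = atom_classes (SOME e. e \<in> P)" for P
  have h: "h (D_class e) = atom_classes e" if "e \<in> E" for e
  proof -
    have "(SOME x. x \<in> D_class e) \<in> D_class e" using D_refl[OF that] by (intro someI) blast
    then show ?thesis unfolding h_def by (intro atom_classes_D_invariant[symmetric]) blast
  qed
  have F: "carrier (free_abelian_monoid ?X) = {A. set_mset A \<subseteq> ?X}"
    by (simp add: free_abelian_monoid_def)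
  have closed: "set_mset (atom_classes e) \<subseteq> ?X" if "e \<in> E" for e
    using finite_atoms_below[OF that] by (auto simp: atom_classes_def atoms_below_def)
  have hom: "h \<in> hom T (free_abelian_monoid ?X)"
  proof (rule homI)
    show "h P \<in> carrier (free_abelian_monoid ?X)" if "P \<in> carrier T" for P
      using that by (rule T_carrierE) (use h closed F in auto)
    show "h (P \<otimes>\<^bsub>T\<^esub> Q) = h P \<otimes>\<^bsub>free_abelian_monoid ?X\<^esub> h Q"
      if P: "P \<in> carrier T" and Q: "Q \<in> carrier T" for P Q
    proof -
      obtain e where e: "e \<in> E" "P = D_class e" using P by (rule T_carrierE)
      obtain f where f: "f \<in> E" "Q = D_class f" using Q by (rule T_carrierE)
      obtain s where "s \<in> E" "P \<otimes>\<^bsub>T\<^esub> Q = D_class s" "atom_classes s = atom_classes e + atom_classes f"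
        unfolding e f using e(1) f(1) by (rule separated_sum)
      then show ?thesis using e f by (simp add: h free_abelian_monoid_def)
    qed
  qed
  have "bij_betw h (carrier T) (carrier (free_abelian_monoid ?X))"
  proof (rule bij_betw_imageI)
    show "inj_on h (carrier T)"
    proof (rule inj_onI)
      fix P Q assume P: "P \<in> carrier T" and Q: "Q \<in> carrier T" and eq: "h P = h Q"
      obtain e where e: "e \<in> E" "P = D_class e" using P by (rule T_carrierE)
      obtain f where f: "f \<in> E" "Q = D_class f" using Q by (rule T_carrierE)
      show "P = Q" using D_if_atom_classes_eq[OF e(1) f(1)] eq e f D_class_eq_iff by (simp add: h)
    qed
    have surj: "\<exists>e\<in>E. atom_classes e = A" if "set_mset A \<subseteq> ?X" for A
      using that
    proof (induction A)
      case empty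
      show ?case using atom_classes_zero by auto
    next
      case (add x A)
      then obtain e where e: "e \<in> E" "atom_classes e = A" by auto
      obtain a where a: "atom a" "x = D_class a" using add.prems by auto
      obtain s where "s \<in> E" "atom_classes s = atom_classes a + atom_classes e"
        using atom_idem[OF a(1)] e(1) by (rule separated_sum)
      then show ?case using a e by (auto simp: atom_classes_atom)
    qed
    show "h ` carrier T = carrier (free_abelian_monoid ?X)"
    proof
      show "h ` carrier T \<subseteq> carrier (free_abelian_monoid ?X)"
        by (intro image_subsetI hom_in_carrier[OF hom])
      show "carrier (free_abelian_monoid ?X) \<subseteq> h ` carrier T"
        using surj h D_class_closed unfolding F by (auto simp: image_iff) metis
    qed
  qed
  with hom show ?thesis by (auto simp: is_iso_def iso_def)
qed

end

section \<open>Semisimplicity\<close>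

context orthogonally_boolean_semigroup
begin

text \<open>
  An element \<open>x\<close> below \<open>a\<close> is \<open>a\<close> restricted to the domain idempotent of \<open>x\<close>, which lies below
  that of \<open>a\<close>; so idempotents decide semisimplicity.
\<close>

lemma semisimple_iff: "semisimple S \<longleftrightarrow> (\<forall>e\<in>E. finite {x \<in> E. x \<preceq> e})"
proof
  assume ss: "semisimple S"
  show "\<forall>e\<in>E. finite {x \<in> E. x \<preceq> e}"
  proof
    fix e assume "e \<in> E"
    then have "finite {x \<in> carrier S. x \<preceq> e}" using ss by (simp add: semisimple_def)
    then show "finite {x \<in> E. x \<preceq> e}" by (rule rev_finite_subset) auto
  qed
next
  assume fin: "\<forall>e\<in>E. finite {x \<in> E. x \<preceq> e}"
  show "semisimple S"
    unfolding semisimple_def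
  proof
    fix a assume [simp]: "a \<in> carrier S"
    have "{x \<in> carrier S. x \<preceq> a} \<subseteq> (\<cdot>) a ` {x \<in> E. x \<preceq> a\<^sup>\<star> \<cdot> a}"
    proof clarify
      fix x assume x [simp]: "x \<in> carrier S" and le: "x \<preceq> a"
      have "x\<^sup>\<star> \<cdot> x \<preceq> x\<^sup>\<star> \<cdot> a" by (rule mult_left_mono[OF le]) simp_all
      moreover have "x\<^sup>\<star> \<cdot> a \<preceq> a\<^sup>\<star> \<cdot> a"
        by (rule mult_right_mono[OF star_mono[OF le]]) simp_all
      ultimately have "x\<^sup>\<star> \<cdot> x \<preceq> a\<^sup>\<star> \<cdot> a" by (rule leq_trans) simp_all
      moreover have "x = a \<cdot> (x\<^sup>\<star> \<cdot> x)" using le by (simp add: leq_iff)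
      ultimately show "x \<in> (\<cdot>) a ` {x \<in> E. x \<preceq> a\<^sup>\<star> \<cdot> a}" by (intro image_eqI[of _ _ "x\<^sup>\<star> \<cdot> x"]) simp_all
    qed
    moreover have "finite {x \<in> E. x \<preceq> a\<^sup>\<star> \<cdot> a}" using fin by simp
    ultimately show "finite {x \<in> carrier S. x \<preceq> a}" using finite_surj by blast
  qed
qed

text \<open>
  The idempotents below a given one in \<open>M\<close> are diagonal, with each entry below the given
  entry and hence zero outside a finite set of positions. In the other direction \<open>E\<close>
  embeds into \<open>M\<close> by placing an idempotent in the corner.
\<close>

lemma M_semisimple_iff:
  "(\<forall>X\<in>idempotents M. finite {Y \<in> idempotents M. Y \<sqsubseteq>\<^bsub>natural_order M\<^esub> X}) \<longleftrightarrow> semisimple S"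
  unfolding semisimple_iff
proof (intro iffI ballI)
  interpret M: orthogonally_boolean_semigroup M by (rule M_orthogonally_boolean)
  fix e assume fin: "\<forall>X\<in>idempotents M. finite {Y \<in> idempotents M. Y \<sqsubseteq>\<^bsub>natural_order M\<^esub> X}"
    and e: "e \<in> E"
  let ?d = "\<lambda>x. diag (\<lambda>i. if i = 0 then x else \<zero>)"
  have d: "?d x \<in> idempotents M" if "x \<in> E" for x
    by (rule diag_idem) (use that in auto)
  have "?d x \<sqsubseteq>\<^bsub>natural_order M\<^esub> ?d e" if x: "x \<in> E" "x \<preceq> e" for x
    unfolding M.idem_leq_iff[OF d[OF e] d[OF x(1)]]
  proof (intro ext)
    fix i j
    have "(?d e \<cdot>\<^bsub>M\<^esub> ?d x) i j = ?d e i i \<cdot> ?d x i j"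
      by (rule M_mult_diagonal[OF M_idem_carrier[OF d[OF e]] M_idem_carrier[OF d[OF x(1)]]])
        (simp add: diag_def)
    then show "?d x i j = (?d e \<cdot>\<^bsub>M\<^esub> ?d x) i j"
      using idem_leq_iff[OF e x(1)] x(2) e by (simp add: diag_def)
  qed
  then have "?d ` {x \<in> E. x \<preceq> e} \<subseteq> {Y \<in> idempotents M. Y \<sqsubseteq>\<^bsub>natural_order M\<^esub> ?d e}"
    using d by blast
  then have "finite (?d ` {x \<in> E. x \<preceq> e})" using fin d[OF e] finite_subset by blast
  moreover have "inj ?d"
    by (rule injI) (drule fun_cong[of _ _ 0], drule fun_cong[of _ _ 0], simp add: diag_def)
  ultimately show "finite {x \<in> E. x \<preceq> e}" using finite_imageD inj_on_subset by blast
next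
  fix X assume fin: "\<forall>e\<in>E. finite {x \<in> E. x \<preceq> e}" and X: "X \<in> idempotents M"
  let ?I = "{i. X i i \<noteq> \<zero>}"
  let ?B = "\<Union>i\<in>?I. {x \<in> E. x \<preceq> X i i}"
  have "finite ?B" using fin M_idem_entry[OF X] M_idem_finite_support[OF X] by blast
  then have "finite {g. \<forall>i. (i \<in> ?I \<longrightarrow> g i \<in> ?B) \<and> (i \<notin> ?I \<longrightarrow> g i = \<zero>)}" (is "finite ?G")
    by (rule finite_set_of_finite_funs[OF M_idem_finite_support[OF X]])
  moreover have "{Y \<in> idempotents M. Y \<sqsubseteq>\<^bsub>natural_order M\<^esub> X} \<subseteq> diag ` ?G"
  proof clarify
    fix Y assume Y: "Y \<in> idempotents M" and le: "Y \<sqsubseteq>\<^bsub>natural_order M\<^esub> X"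
    have YX: "Y i i \<preceq> X i i" for i by (rule M_idem_leqD[OF X Y le])
    have "Y i i = \<zero>" if "X i i = \<zero>" for i
      using YX[of i] leq_zero_iff[OF idem_closed[OF M_idem_entry[OF Y]], of i] by (simp add: that)
    moreover have "Y i i \<in> ?B" if "X i i \<noteq> \<zero>" for i
      using YX[of i] M_idem_entry[OF Y, of i] that by blast
    ultimately have "(\<lambda>i. Y i i) \<in> ?G" by simp
    then show "Y \<in> diag ` ?G" by (rule rev_image_eqI) (rule M_idem_eq_diag[OF Y])
  qed
  ultimately show "finite {Y \<in> idempotents M. Y \<sqsubseteq>\<^bsub>natural_order M\<^esub> X}" using finite_surj by blast
qed

text \<open>
  Stated for \<open>X\<close> over an arbitrary type, since the theorem uses it for two different ones.
\<close>

lemma semisimple_if_type_monoid_free: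
  assumes "type_monoid S \<cong> free_abelian_monoid X"
  shows "semisimple S"
proof -
  interpret M: orthogonally_boolean_semigroup M by (rule M_orthogonally_boolean)
  show ?thesis
    using M.finite_downset_if_free assms M_semisimple_iff
    unfolding type_monoid_eq_D_class_monoid by blast
qed

end

theorem theorem6p12:
  fixes S :: "('a, 'b) semigroup_with_zero_scheme"
  assumes "boolean_inverse_semigroup S"
  shows "((\<exists>X :: (nat \<Rightarrow> nat \<Rightarrow> 'a) set set. X \<noteq> {} \<and> type_monoid S \<cong> free_abelian_monoid X)
            \<longleftrightarrow> semisimple S) \<and>
         (\<forall>X :: 'x set. X \<noteq> {} \<and> type_monoid S \<cong> free_abelian_monoid X \<longrightarrow> semisimple S)"
proof -
  interpret S: boolean_inverse_semigroup S by (rule assms)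
  interpret O: orthogonally_boolean_semigroup S by (rule S.orthogonally_boolean)
  interpret M: orthogonally_boolean_semigroup O.M by (rule O.M_orthogonally_boolean)
  have free: "\<exists>X :: (nat \<Rightarrow> nat \<Rightarrow> 'a) set set. X \<noteq> {} \<and> type_monoid S \<cong> free_abelian_monoid X"
    if "semisimple S"
  proof -
    interpret M: atomic_separating_semigroup O.M
      using that O.M_semisimple_iff O.M_orthogonally_separating by unfold_locales blast+
    \<comment> \<open>Since \<open>S\<close> is not trivial, \<open>M\<close> has a non-zero idempotent, and an atom lies below it.\<close>
    obtain a where a: "a \<in> carrier S" "a \<noteq> sg_zero S" using S.nontrivial S.zero_closed by blast
    define e where "e = sg_inv S a \<cdot>\<^bsub>S\<^esub> a"
    have e: "e \<in> idempotents S" "e \<noteq> sg_zero S"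
      using a S.star_regular[of a] by (auto simp: e_def simp del: S.star_regular)
    define X where "X = O.diag (\<lambda>i. if i = 0 then e else sg_zero S)"
    have X: "X \<in> idempotents O.M"
      unfolding X_def by (rule O.diag_idem) (use e in auto)
    have "X 0 0 \<noteq> sg_zero O.M 0 0" using e(2) by (simp add: X_def O.diag_def O.M_zero)
    then have "X \<noteq> sg_zero O.M" by auto
    then obtain A where "M.atom A" using M.exists_atom_below X M.finite_downsets by blast
    then have "M.D_class ` {A. M.atom A} \<noteq> {}" by blast
    moreover have "type_monoid S \<cong> free_abelian_monoid (M.D_class ` {A. M.atom A})"
      unfolding type_monoid_eq_D_class_monoid by (rule M.D_class_monoid_free)
    ultimately show ?thesis by (intro exI conjI)
  qed
  show ?thesis
  proof (intro conjI iffI allI impI)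
    show "semisimple S"
      if "\<exists>X :: (nat \<Rightarrow> nat \<Rightarrow> 'a) set set. X \<noteq> {} \<and> type_monoid S \<cong> free_abelian_monoid X"
      using that O.semisimple_if_type_monoid_free by blast
    show "semisimple S" if "X \<noteq> {} \<and> type_monoid S \<cong> free_abelian_monoid X" for X :: "'x set"
      using that O.semisimple_if_type_monoid_free by blast
  qed (rule free)
qed

end
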